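(* Let $A$ and $B$ be irreducible, non-permutation square matrices with entries in $\{0,1\}$ (of sizes greater than $1$). Suppose that the one-sided topological Markov shifts $(X_A,\sigma_A)$ and $(X_B,\sigma_B)$ are continuously orbit equivalent via a homeomorphism $h:X_A\to X_B$, with cocycle function $c_1\in C(X_A,\mathbb{Z})$ for $h$ and cocycle function $c_2\in C(X_B,\mathbb{Z})$ for $h^{-1}$. Let $\varphi_A$ and $\varphi_B$ be the unique KMS states for the gauge actions on the Cuntz--Krieger algebras $\mathcal{O}_A$ and $\mathcal{O}_B$, respectively. Let $r_A$ and $r_B$ be the Perron--Frobenius eigenvalues of $A$ and $B$, and let $h_{top}(\sigma_A)$ and $h_{top}(\sigma_B)$ denote the topological entropy of $(X_A,\sigma_A)$ and $(X_B,\sigma_B)$, respectively. Then $$h_{top}(\sigma_A) = -\lim_{n\to\infty}\frac{1}{n}\log\varphi_A\bigl(r_B^{-c_1^n}\bigr),\qquad h_{top}(\sigma_B) = -\lim_{n\to\infty}\frac{1}{n}\log\varphi_B\bigl(r_A^{-c_2^n}\bigr),$$ where $r_B^{-c_1^n}\in C(X_A)$ is defined by $r_B^{-c_1^n}(x)=r_B^{-\sum_{k=0}^{n-1}c_1(\sigma_A^k(x))}$ for $x\in X_A$, and $r_A^{-c_2^n}\in C(X_B)$ is defined by $r_A^{-c_2^n}(y)=r_A^{-\sum_{k=0}^{n-1}c_2(\sigma_B^k(y))}$ for $y\in X_B$.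
   Context: Markov shifts. For an $N\times N$ matrix $A$ with entries in $\{0,1\}$, $N>1$, $X_A$ is the compact space of sequences $(x_n)_{n\in\mathbb{N}}\in\{1,\dots,N\}^{\mathbb{N}}$ with $A(x_n,x_{n+1})=1$ for all $n$ (subspace of the product topology), and $\sigma_A:X_A\to X_A$, $\sigma_A((x_n)_n)=(x_{n+1})_n$. A word $\mu=(\mu_1,\dots,\mu_k)$ is admissible if it appears in some $x\in X_A$; $U_\mu=\{x\in X_A: x_1=\mu_1,\dots,x_k=\mu_k\}$ is its cylinder set. Cuntz--Krieger algebra. $\mathcal{O}_A$ is the universal $C^*$-algebra generated by partial isometries $S_1,\dots,S_N$ with $\sum_{j=1}^N S_jS_j^*=1$ and $S_i^*S_i=\sum_{j=1}^N A(i,j)S_jS_j^*$ for $i=1,\dots,N$. For $\mu=(\mu_1,\dots,\mu_k)$ write $S_\mu=S_{\mu_1}\cdots S_{\mu_k}$. $\mathcal{D}_A$ is the $C^*$-subalgebra generated by the projections $S_\mu S_\mu^*$, $\mu$ admissible; it is identified with $C(X_A)$ (complex-valued continuous functions) via $S_\mu S_\mu^*\leftrightarrow\chi_{U_\mu}$. Thus elements of $C(X_A)$ are regarded as elements of $\mathcal{O}_A$. Gauge action and KMS states. The gauge action $\gamma^A$ of $\mathbb{R}$ on $\mathcal{O}_A$ is given by $\gamma^A_t(S_j)=e^{\sqrt{-1}\,t}S_j$. For an action $\alpha$ of $\mathbb{R}$ on $\mathcal{O}_A$ and a positive real $\beta$, a state $\psi$ on $\mathcal{O}_A$ is a $\log\beta$-KMS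 state for $\alpha$ if $\psi(y\,\alpha_{i\log\beta}(x))=\psi(xy)$ for all analytic elements $x$ of $\alpha$ and all $y\in\mathcal{O}_A$. It is known (Enomoto--Fujii--Watatani) that for $A$ irreducible and not a permutation, $\gamma^A$ has a $\log\beta$-KMS state if and only if $\beta=r_A$, the Perron--Frobenius eigenvalue of $A$, and that this KMS state is faithful and unique; it is denoted $\varphi_A$. Continuous orbit equivalence. $(X_A,\sigma_A)$ and $(X_B,\sigma_B)$ are continuously orbit equivalent (via $h$) if there are a homeomorphism $h:X_A\to X_B$ and continuous functions $k_1,l_1:X_A\to\mathbb{Z}_+$, $k_2,l_2:X_B\to\mathbb{Z}_+$ ($\mathbb{Z}_+=\{0,1,2,\dots\}$) with $$\sigma_B^{k_1(x)}(h(\sigma_A(x)))=\sigma_B^{l_1(x)}(h(x))\ (x\in X_A),\qquad \sigma_A^{k_2(y)}(h^{-1}(\sigma_B(y)))=\sigma_A^{l_2(y)}(h^{-1}(y))\ (y\in X_B).$$ The cocycle function for $h$ is $c_1=l_1-k_1$ and the cocycle function for $h^{-1}$ is $c_2=l_2-k_2$. *)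

theory Defs
  imports
    "HOL-Analysis.Analysis"
    "HOL-Algebra.Ring"
    "Jordan_Normal_Form.Spectral_Radius"
begin

section \<open>Topological Markov shifts\<close>

text \<open>The alphabet of an \<open>N \<times> N\<close> matrix is \<open>{0..<N}\<close> instead of \<open>{1..N}\<close>, and sequences are
  indexed from \<open>0\<close>. The topology on \<open>nat \<Rightarrow> nat\<close> is the library's product topology, with \<open>nat\<close>
  discrete.\<close>

definition zero_one_mat :: "nat mat \<Rightarrow> bool" where
  "zero_one_mat A \<longleftrightarrow> square_mat A \<and> dim_row A > 1 \<and>
     (\<forall>i<dim_row A. \<forall>j<dim_row A. A $$ (i, j) \<in> {0, 1})"

definition irreducible_mat :: "nat mat \<Rightarrow> bool" where
  "irreducible_mat A \<longleftrightarrow>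
     (\<forall>i<dim_row A. \<forall>j<dim_row A. \<exists>n>0. (A ^\<^sub>m n) $$ (i, j) > 0)"

definition permutation_mat :: "nat mat \<Rightarrow> bool" where
  "permutation_mat A \<longleftrightarrow>
     (\<exists>p. p permutes {..<dim_row A} \<and>
        (\<forall>i<dim_row A. \<forall>j<dim_row A. A $$ (i, j) = (if j = p i then 1 else 0)))"

definition perron_eigenvalue :: "nat mat \<Rightarrow> real" where
  "perron_eigenvalue A = spectral_radius (map_mat of_nat A)"

definition markov_space :: "nat mat \<Rightarrow> (nat \<Rightarrow> nat) set" where
  "markov_space A = {x. \<forall>n. x n < dim_row A \<and> A $$ (x n, x (Suc n)) = 1}"

definition shift :: "(nat \<Rightarrow> nat) \<Rightarrow> nat \<Rightarrow> nat" where
  "shift x = (\<lambda>n. x (Suc n))"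

definition admissible :: "nat mat \<Rightarrow> nat list \<Rightarrow> bool" where
  "admissible A \<mu> \<longleftrightarrow> \<mu> \<noteq> [] \<and>
     (\<exists>x\<in>markov_space A. \<exists>m. \<forall>i<length \<mu>. x (m + i) = \<mu> ! i)"

definition cylinder :: "nat mat \<Rightarrow> nat list \<Rightarrow> (nat \<Rightarrow> nat) set" where
  "cylinder A \<mu> = {x \<in> markov_space A. \<forall>i<length \<mu>. x i = \<mu> ! i}"

text \<open>Here \<open>g\<close> is the inverse of \<open>h\<close>.\<close>

definition continuous_orbit_equivalence ::
  "nat mat \<Rightarrow> nat mat \<Rightarrow> ((nat \<Rightarrow> nat) \<Rightarrow> nat \<Rightarrow> nat) \<Rightarrow> ((nat \<Rightarrow> nat) \<Rightarrow> nat \<Rightarrow> nat) \<Rightarrow>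
   ((nat \<Rightarrow> nat) \<Rightarrow> nat) \<Rightarrow> ((nat \<Rightarrow> nat) \<Rightarrow> nat) \<Rightarrow>
   ((nat \<Rightarrow> nat) \<Rightarrow> nat) \<Rightarrow> ((nat \<Rightarrow> nat) \<Rightarrow> nat) \<Rightarrow> bool" where
  "continuous_orbit_equivalence A B h g k\<^sub>1 l\<^sub>1 k\<^sub>2 l\<^sub>2 \<longleftrightarrow>
     homeomorphism (markov_space A) (markov_space B) h g \<and>
     continuous_on (markov_space A) k\<^sub>1 \<and> continuous_on (markov_space A) l\<^sub>1 \<and>
     continuous_on (markov_space B) k\<^sub>2 \<and> continuous_on (markov_space B) l\<^sub>2 \<and>
     (\<forall>x\<in>markov_space A. (shift ^^ k\<^sub>1 x) (h (shift x)) = (shift ^^ l\<^sub>1 x) (h x)) \<and>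
     (\<forall>y\<in>markov_space B. (shift ^^ k\<^sub>2 y) (g (shift y)) = (shift ^^ l\<^sub>2 y) (g y))"

definition cocycle :: "('x \<Rightarrow> nat) \<Rightarrow> ('x \<Rightarrow> nat) \<Rightarrow> 'x \<Rightarrow> int" where
  "cocycle k l x = int (l x) - int (k x)"

definition cocycle_sum :: "((nat \<Rightarrow> nat) \<Rightarrow> int) \<Rightarrow> nat \<Rightarrow> (nat \<Rightarrow> nat) \<Rightarrow> int" where
  "cocycle_sum c n x = (\<Sum>k<n. c ((shift ^^ k) x))"


section \<open>Topological entropy\<close>

text \<open>The definition of Adler, Konheim and McAndrew by open covers, for a continuous self-map
  \<open>T\<close> of a compact space \<open>X\<close>.\<close>

definition open_cover :: "'x::topological_space set \<Rightarrow> 'x set set \<Rightarrow> bool" where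
  "open_cover X \<U> \<longleftrightarrow> (\<forall>U\<in>\<U>. openin (top_of_set X) U) \<and> \<Union>\<U> = X"

definition min_subcover_card :: "'x set \<Rightarrow> 'x set set \<Rightarrow> nat" where
  "min_subcover_card X \<U> = (LEAST m. \<exists>\<V>\<subseteq>\<U>. finite \<V> \<and> card \<V> = m \<and> \<Union>\<V> = X)"

text \<open>The common refinement of the covers \<open>T\<^sup>-\<^sup>k \<U>\<close> for \<open>k < n\<close>.\<close>

definition iterated_join :: "'x set \<Rightarrow> ('x \<Rightarrow> 'x) \<Rightarrow> 'x set set \<Rightarrow> nat \<Rightarrow> 'x set set" where
  "iterated_join X T \<U> n =
     {{x \<in> X. \<forall>k<n. (T ^^ k) x \<in> U k} | U. \<forall>k<n. U k \<in> \<U>}"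

definition cover_entropy :: "'x set \<Rightarrow> ('x \<Rightarrow> 'x) \<Rightarrow> 'x set set \<Rightarrow> ereal" where
  "cover_entropy X T \<U> =
     lim (\<lambda>n. ereal (1 / real n * ln (real (min_subcover_card X (iterated_join X T \<U> n)))))"

definition topological_entropy :: "'x::topological_space set \<Rightarrow> ('x \<Rightarrow> 'x) \<Rightarrow> ereal" where
  "topological_entropy X T = (SUP \<U>\<in>{\<U>. open_cover X \<U>}. cover_entropy X T \<U>)"


section \<open>Unital \<open>C\<^sup>*\<close>-algebras\<close>

record 'a cstar = "'a ring" +
  cscale :: "complex \<Rightarrow> 'a \<Rightarrow> 'a"
  star :: "'a \<Rightarrow> 'a"
  cnorm :: "'a \<Rightarrow> real"

text \<open>The locale \<open>Metric_space\<close> demands nonnegativity and symmetry off the carrier as well, hence the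
  default value.\<close>

definition cdist :: "'a cstar \<Rightarrow> 'a \<Rightarrow> 'a \<Rightarrow> real" where
  "cdist R x y = (if x \<in> carrier R \<and> y \<in> carrier R then cnorm R (x \<ominus>\<^bsub>R\<^esub> y) else 0)"

locale cstar_algebra = ring R for R :: "'a cstar" (structure) +
  assumes cscale_closed: "x \<in> carrier R \<Longrightarrow> cscale R a x \<in> carrier R"
    and cscale_add_right: "x \<in> carrier R \<Longrightarrow> y \<in> carrier R \<Longrightarrow>
      cscale R a (x \<oplus> y) = cscale R a x \<oplus> cscale R a y"
    and cscale_add_left: "x \<in> carrier R \<Longrightarrow> cscale R (a + b) x = cscale R a x \<oplus> cscale R b x"
    and cscale_cscale: "x \<in> carrier R \<Longrightarrow> cscale R a (cscale R b x) = cscale R (a * b) x"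
    and cscale_one: "x \<in> carrier R \<Longrightarrow> cscale R 1 x = x"
    and cscale_mult_left: "x \<in> carrier R \<Longrightarrow> y \<in> carrier R \<Longrightarrow>
      cscale R a x \<otimes> y = cscale R a (x \<otimes> y)"
    and cscale_mult_right: "x \<in> carrier R \<Longrightarrow> y \<in> carrier R \<Longrightarrow>
      x \<otimes> cscale R a y = cscale R a (x \<otimes> y)"
    and star_closed: "x \<in> carrier R \<Longrightarrow> star R x \<in> carrier R"
    and star_star: "x \<in> carrier R \<Longrightarrow> star R (star R x) = x"
    and star_add: "x \<in> carrier R \<Longrightarrow> y \<in> carrier R \<Longrightarrow>
      star R (x \<oplus> y) = star R x \<oplus> star R y"
    and star_cscale: "x \<in> carrier R \<Longrightarrow> star R (cscale R a x) = cscale R (cnj a) (star R x)"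
    and star_mult: "x \<in> carrier R \<Longrightarrow> y \<in> carrier R \<Longrightarrow>
      star R (x \<otimes> y) = star R y \<otimes> star R x"
    and cnorm_nonneg: "x \<in> carrier R \<Longrightarrow> cnorm R x \<ge> 0"
    and cnorm_eq_zero: "x \<in> carrier R \<Longrightarrow> cnorm R x = 0 \<longleftrightarrow> x = \<zero>"
    and cnorm_triangle: "x \<in> carrier R \<Longrightarrow> y \<in> carrier R \<Longrightarrow>
      cnorm R (x \<oplus> y) \<le> cnorm R x + cnorm R y"
    and cnorm_cscale: "x \<in> carrier R \<Longrightarrow> cnorm R (cscale R a x) = cmod a * cnorm R x"
    and cnorm_mult: "x \<in> carrier R \<Longrightarrow> y \<in> carrier R \<Longrightarrow>
      cnorm R (x \<otimes> y) \<le> cnorm R x * cnorm R y"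
    and cstar_identity: "x \<in> carrier R \<Longrightarrow> cnorm R (star R x \<otimes> x) = (cnorm R x)\<^sup>2"
    and complete: "Metric_space.mcomplete (carrier R) (cdist R)"

text \<open>Homomorphisms are unital.\<close>

definition star_hom :: "'a cstar \<Rightarrow> 'b cstar \<Rightarrow> ('a \<Rightarrow> 'b) \<Rightarrow> bool" where
  "star_hom R Q \<pi> \<longleftrightarrow> \<pi> \<in> ring_hom R Q \<and>
     (\<forall>x\<in>carrier R. \<forall>a. \<pi> (cscale R a x) = cscale Q a (\<pi> x)) \<and>
     (\<forall>x\<in>carrier R. \<pi> (star R x) = star Q (\<pi> x))"

definition closed_star_subalgebra :: "'a cstar \<Rightarrow> 'a set \<Rightarrow> bool" where
  "closed_star_subalgebra R D \<longleftrightarrow> D \<subseteq> carrier R \<and> \<zero>\<^bsub>R\<^esub> \<in> D \<and>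
     (\<forall>x\<in>D. \<forall>y\<in>D. x \<oplus>\<^bsub>R\<^esub> y \<in> D \<and> x \<otimes>\<^bsub>R\<^esub> y \<in> D) \<and>
     (\<forall>x\<in>D. star R x \<in> D \<and> (\<forall>a. cscale R a x \<in> D)) \<and>
     closedin (Metric_space.mtopology (carrier R) (cdist R)) D"

definition cstar_generated :: "'a cstar \<Rightarrow> 'a set \<Rightarrow> 'a set" where
  "cstar_generated R G = \<Inter>{D. closed_star_subalgebra R D \<and> G \<subseteq> D}"

definition partial_isometry :: "'a cstar \<Rightarrow> 'a \<Rightarrow> bool" where
  "partial_isometry R s \<longleftrightarrow> s \<in> carrier R \<and> s \<otimes>\<^bsub>R\<^esub> star R s \<otimes>\<^bsub>R\<^esub> s = s"

definition state :: "'a cstar \<Rightarrow> ('a \<Rightarrow> complex) \<Rightarrow> bool" where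
  "state R \<psi> \<longleftrightarrow>
     (\<forall>x\<in>carrier R. \<forall>y\<in>carrier R. \<psi> (x \<oplus>\<^bsub>R\<^esub> y) = \<psi> x + \<psi> y) \<and>
     (\<forall>x\<in>carrier R. \<forall>a. \<psi> (cscale R a x) = a * \<psi> x) \<and>
     (\<forall>x\<in>carrier R. \<psi> (star R x \<otimes>\<^bsub>R\<^esub> x) \<in> \<real>\<^sub>\<ge>\<^sub>0) \<and> \<psi> \<one>\<^bsub>R\<^esub> = 1"

text \<open>\<open>C(X)\<close> for compact \<open>X\<close>; functions on \<open>X\<close> are represented extensionally.\<close>

definition cfun_algebra :: "'x::topological_space set \<Rightarrow> ('x \<Rightarrow> complex) cstar" where
  "cfun_algebra X =
     \<lparr>carrier = {f \<in> extensional X. continuous_on X f},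
      mult = (\<lambda>f g. \<lambda>x\<in>X. f x * g x), one = (\<lambda>x\<in>X. 1),
      zero = (\<lambda>x\<in>X. 0), add = (\<lambda>f g. \<lambda>x\<in>X. f x + g x),
      cscale = (\<lambda>a f. \<lambda>x\<in>X. a * f x), star = (\<lambda>f. \<lambda>x\<in>X. cnj (f x)),
      cnorm = (\<lambda>f. if X = {} then 0 else SUP x\<in>X. cmod (f x))\<rparr>"


section \<open>Actions of the reals and KMS states\<close>

definition real_action :: "'a cstar \<Rightarrow> (real \<Rightarrow> 'a \<Rightarrow> 'a) \<Rightarrow> bool" where
  "real_action R \<alpha> \<longleftrightarrow>
     (\<forall>t. star_hom R R (\<alpha> t) \<and> bij_betw (\<alpha> t) (carrier R) (carrier R)) \<and>
     (\<forall>x\<in>carrier R. \<alpha> 0 x = x \<and> (\<forall>s t. \<alpha> (s + t) x = \<alpha> s (\<alpha> t x))) \<and>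
     (\<forall>x\<in>carrier R. \<forall>t. ((\<lambda>s. cdist R (\<alpha> s x) (\<alpha> t x)) \<longlongrightarrow> 0) (at t))"

text \<open>\<open>F\<close> is an entire extension of \<open>t \<mapsto> \<alpha>\<^sub>t(x)\<close>: it is complex differentiable in norm at every
  point. An element \<open>x\<close> is analytic for \<open>\<alpha>\<close> iff such an \<open>F\<close> exists; \<open>F\<close> is then unique and
  \<open>\<alpha>\<^sub>z(x) = F z\<close>.\<close>

definition entire_extension ::
  "'a cstar \<Rightarrow> (real \<Rightarrow> 'a \<Rightarrow> 'a) \<Rightarrow> 'a \<Rightarrow> (complex \<Rightarrow> 'a) \<Rightarrow> bool" where
  "entire_extension R \<alpha> x F \<longleftrightarrow>
     (\<forall>z. F z \<in> carrier R) \<and> (\<forall>t. F (complex_of_real t) = \<alpha> t x) \<and>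
     (\<forall>z. \<exists>D\<in>carrier R.
        ((\<lambda>w. cdist R (cscale R (1 / (w - z)) (F w \<ominus>\<^bsub>R\<^esub> F z)) D) \<longlongrightarrow> 0) (at z))"

text \<open>\<open>kms_state R \<alpha> \<beta> \<psi>\<close>: \<open>\<psi>\<close> is a \<open>log \<beta>\<close>-KMS state for \<open>\<alpha>\<close>.\<close>

definition kms_state ::
  "'a cstar \<Rightarrow> (real \<Rightarrow> 'a \<Rightarrow> 'a) \<Rightarrow> real \<Rightarrow> ('a \<Rightarrow> complex) \<Rightarrow> bool" where
  "kms_state R \<alpha> \<beta> \<psi> \<longleftrightarrow> \<beta> > 0 \<and> state R \<psi> \<and>
     (\<forall>x\<in>carrier R. \<forall>y\<in>carrier R. \<forall>F. entire_extension R \<alpha> x F \<longrightarrow>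
        \<psi> (y \<otimes>\<^bsub>R\<^esub> F (\<i> * complex_of_real (ln \<beta>))) = \<psi> (x \<otimes>\<^bsub>R\<^esub> y))"


section \<open>Cuntz--Krieger algebras\<close>

definition cuntz_krieger_family :: "nat mat \<Rightarrow> 'a cstar \<Rightarrow> (nat \<Rightarrow> 'a) \<Rightarrow> bool" where
  "cuntz_krieger_family A R S \<longleftrightarrow>
     (\<forall>i<dim_row A. partial_isometry R (S i)) \<and>
     (\<Oplus>\<^bsub>R\<^esub>j\<in>{..<dim_row A}. S j \<otimes>\<^bsub>R\<^esub> star R (S j)) = \<one>\<^bsub>R\<^esub> \<and>
     (\<forall>i<dim_row A. star R (S i) \<otimes>\<^bsub>R\<^esub> S i =
        (\<Oplus>\<^bsub>R\<^esub>j\<in>{..<dim_row A}. cscale R (of_nat (A $$ (i, j))) (S j \<otimes>\<^bsub>R\<^esub> star R (S j))))"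

text \<open>\<open>(R, S)\<close> is a universal \<open>C\<^sup>*\<close>-algebra generated by a Cuntz--Krieger family. HOL cannot
  quantify over all carrier types inside a formula, so the universal property is tested on the
  \<open>C\<^sup>*\<close>-algebras \<open>Q\<close> whose carrier is a set of reals (with arbitrary operations). This is no
  restriction: the \<open>C\<^sup>*\<close>-subalgebra generated by a finite family is separable, so it has at most
  the cardinality of the continuum and is isomorphic to some such \<open>Q\<close>. Uniqueness of \<open>\<pi>\<close> follows
  from generation.\<close>

definition cuntz_krieger_algebra :: "nat mat \<Rightarrow> 'a cstar \<Rightarrow> (nat \<Rightarrow> 'a) \<Rightarrow> bool" where
  "cuntz_krieger_algebra A R S \<longleftrightarrow>
     cstar_algebra R \<and> cuntz_krieger_family A R S \<and>
     cstar_generated R (S ` {..<dim_row A}) = carrier R \<and>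
     (\<forall>(Q :: real cstar) T. cstar_algebra Q \<and> cuntz_krieger_family A Q T \<longrightarrow>
        (\<exists>\<pi>. star_hom R Q \<pi> \<and> (\<forall>i<dim_row A. \<pi> (S i) = T i)))"

definition word_prod :: "'a cstar \<Rightarrow> (nat \<Rightarrow> 'a) \<Rightarrow> nat list \<Rightarrow> 'a" where
  "word_prod R S \<mu> = foldr (\<lambda>i a. S i \<otimes>\<^bsub>R\<^esub> a) \<mu> \<one>\<^bsub>R\<^esub>"

definition word_proj :: "'a cstar \<Rightarrow> (nat \<Rightarrow> 'a) \<Rightarrow> nat list \<Rightarrow> 'a" where
  "word_proj R S \<mu> = word_prod R S \<mu> \<otimes>\<^bsub>R\<^esub> star R (word_prod R S \<mu>)"

definition diagonal_subalgebra :: "nat mat \<Rightarrow> 'a cstar \<Rightarrow> (nat \<Rightarrow> 'a) \<Rightarrow> 'a set" where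
  "diagonal_subalgebra A R S = cstar_generated R {word_proj R S \<mu> | \<mu>. admissible A \<mu>}"

text \<open>\<open>\<iota>\<close> is the identification of \<open>C(X\<^sub>A)\<close> with the diagonal subalgebra; these conditions determine
  it on \<open>C(X\<^sub>A)\<close>.\<close>

definition diagonal_identification ::
  "nat mat \<Rightarrow> 'a cstar \<Rightarrow> (nat \<Rightarrow> 'a) \<Rightarrow> (((nat \<Rightarrow> nat) \<Rightarrow> complex) \<Rightarrow> 'a) \<Rightarrow> bool" where
  "diagonal_identification A R S \<iota> \<longleftrightarrow>
     star_hom (cfun_algebra (markov_space A)) R \<iota> \<and>
     bij_betw \<iota> (carrier (cfun_algebra (markov_space A))) (diagonal_subalgebra A R S) \<and>
     (\<forall>\<mu>. admissible A \<mu> \<longrightarrow>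
        \<iota> (\<lambda>x\<in>markov_space A. indicator (cylinder A \<mu>) x) = word_proj R S \<mu>)"

definition gauge_action ::
  "nat mat \<Rightarrow> 'a cstar \<Rightarrow> (nat \<Rightarrow> 'a) \<Rightarrow> (real \<Rightarrow> 'a \<Rightarrow> 'a) \<Rightarrow> bool" where
  "gauge_action A R S \<gamma> \<longleftrightarrow> real_action R \<gamma> \<and>
     (\<forall>t. \<forall>j<dim_row A. \<gamma> t (S j) = cscale R (exp (\<i> * complex_of_real t)) (S j))"

definition cocycle_weight ::
  "nat mat \<Rightarrow> real \<Rightarrow> ((nat \<Rightarrow> nat) \<Rightarrow> int) \<Rightarrow> nat \<Rightarrow> (nat \<Rightarrow> nat) \<Rightarrow> complex" where
  "cocycle_weight A r c n =
     (\<lambda>x\<in>markov_space A. complex_of_real (r powr (- real_of_int (cocycle_sum c n x))))"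

end

theory Submission
  imports Defs "HOL-Real_Asymp.Real_Asymp"
begin

text \<open>The KMS condition says that a KMS state restricted to \<open>C(X\<^sub>A)\<close> is a finitely additive
  measure \<open>\<mu>\<close> on clopen sets with \<open>\<mu>(\<sigma>\<^sub>A E) = r\<^sub>A \<mu>(E)\<close> whenever \<open>\<sigma>\<^sub>A\<close> is injective on \<open>E\<close>.
  Irreducibility makes \<open>\<mu>\<close> positive on cylinders, so the number of words of length \<open>n\<close> is comparable
  to \<open>r\<^sub>A\<^sup>n\<close> and the entropy is \<open>log r\<^sub>A\<close>; neither Perron--Frobenius theory nor uniqueness of the KMS
  state is needed. Let \<open>\<nu>\<close> be the pullback along \<open>h\<close> of the measure of \<open>B\<close>. The orbit equivalence
  gives \<open>\<nu>(\<sigma>\<^sub>A E) = r\<^sub>B\<^bsup>c\<^sub>1\<^esup> \<nu>(E)\<close> for small \<open>E\<close>. Hence on a cylinder \<open>U\<close> of length \<open>n + m\<close>, for a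
  fixed \<open>m\<close>, the integral of \<open>r\<^sub>B\<^bsup>-c\<^sub>1\<^sup>n\<^esup>\<close> against \<open>\<mu>\<close> is
  \<open>r\<^sub>A\<^sup>-\<^sup>n \<nu>(U) \<mu>(\<sigma>\<^sub>A\<^sup>n U) / \<nu>(\<sigma>\<^sub>A\<^sup>n U)\<close>. The last quotient takes finitely many positive values and
  \<open>\<nu>\<close> has total mass one, so the whole integral is \<open>r\<^sub>A\<^sup>-\<^sup>n\<close> up to bounded factors.\<close>

section \<open>Cylinder sets\<close>

definition initial_word :: "nat \<Rightarrow> (nat \<Rightarrow> nat) \<Rightarrow> nat list" where
  "initial_word n x = map x [0..<n]"

definition words :: "nat mat \<Rightarrow> nat \<Rightarrow> nat list set" where
  "words A n = initial_word n ` markov_space A"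

definition determined_at :: "nat mat \<Rightarrow> nat \<Rightarrow> (nat \<Rightarrow> nat) set \<Rightarrow> bool" where
  "determined_at A n E \<longleftrightarrow> E \<subseteq> markov_space A \<and>
     (\<forall>x\<in>E. \<forall>y\<in>markov_space A. initial_word n y = initial_word n x \<longrightarrow> y \<in> E)"

text \<open>By \<open>clopen_imp_cylindrical\<close> and \<open>cylindrical_imp_clopen\<close> these
  are exactly the clopen subsets of the shift space. The combinatorial form lets a finitely additive
  function on them be computed by finite sums over words.\<close>

definition cylindrical :: "nat mat \<Rightarrow> (nat \<Rightarrow> nat) set \<Rightarrow> bool" where
  "cylindrical A E \<longleftrightarrow> (\<exists>n. determined_at A n E)"

lemma length_initial_word [simp]: "length (initial_word n x) = n"
  by (simp add: initial_word_def)

lemma nth_initial_word [simp]: "i < n \<Longrightarrow> initial_word n x ! i = x i"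
  by (simp add: initial_word_def)

lemma initial_word_eq_iff: "initial_word n x = initial_word n y \<longleftrightarrow> (\<forall>i<n. x i = y i)"
  by (auto simp: initial_word_def)

lemma initial_word_Suc: "initial_word (Suc n) x = x 0 # initial_word n (shift x)"
  by (auto simp: list_eq_iff_nth_eq nth_Cons shift_def split: nat.split)

lemma funpow_shift: "(shift ^^ n) x = (\<lambda>i. x (n + i))"
  by (induction n arbitrary: x) (auto simp: shift_def)

lemma cylinder_initial_word:
  "cylinder A (initial_word n x) = {y \<in> markov_space A. initial_word n y = initial_word n x}"
  by (auto simp: cylinder_def initial_word_eq_iff)

lemma cylinder_word:
  "w \<in> words A n \<Longrightarrow> cylinder A w = {y \<in> markov_space A. initial_word n y = w}"
  by (auto simp: words_def cylinder_initial_word)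

lemma shift_in_markov_space: "x \<in> markov_space A \<Longrightarrow> shift x \<in> markov_space A"
  by (auto simp: markov_space_def shift_def)

lemma funpow_shift_in_markov_space: "x \<in> markov_space A \<Longrightarrow> (shift ^^ n) x \<in> markov_space A"
  by (induction n) (auto intro: shift_in_markov_space)

lemma finite_words: "finite (words A n)"
proof (rule finite_subset)
  show "words A n \<subseteq> {w. set w \<subseteq> {..<dim_row A} \<and> length w = n}"
    by (auto simp: words_def initial_word_def markov_space_def)
  show "finite {w. set w \<subseteq> {..<dim_row A} \<and> length w = n}"
    by (rule finite_lists_length_eq) simp
qed

lemma determined_at_mono:
  assumes "determined_at A n E" "n \<le> m" shows "determined_at A m E"
  using assms unfolding determined_at_def initial_word_eq_iff by (meson order_less_le_trans)

lemma determined_at_cylinder: "determined_at A n (cylinder A (initial_word n x))"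
  by (auto simp: determined_at_def cylinder_initial_word)

lemma determined_at_UN:
  "(\<And>i. i \<in> I \<Longrightarrow> determined_at A n (E i)) \<Longrightarrow> determined_at A n (\<Union>i\<in>I. E i)"
  unfolding determined_at_def by blast

lemma cylindrical_cylinder: "w \<in> words A n \<Longrightarrow> cylindrical A (cylinder A w)"
  by (auto simp: cylindrical_def words_def intro: determined_at_cylinder)

lemma cylindrical_UN:
  assumes "finite I" "\<And>i. i \<in> I \<Longrightarrow> cylindrical A (E i)"
  shows "cylindrical A (\<Union>i\<in>I. E i)"
proof -
  from assms(2) obtain n where n: "\<And>i. i \<in> I \<Longrightarrow> determined_at A (n i) (E i)"
    unfolding cylindrical_def by metis
  have "determined_at A (Max (n ` I)) (\<Union>i\<in>I. E i)"
    by (rule determined_at_UN, rule determined_at_mono[OF n]) (auto simp: assms(1))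
  then show ?thesis by (auto simp: cylindrical_def)
qed

lemma determined_at_eq_UN_cylinders:
  "determined_at A n E \<Longrightarrow> E = (\<Union>w\<in>initial_word n ` E. cylinder A w)"
  by (force simp: determined_at_def cylinder_initial_word)

lemma initial_word_image_subset_words: "E \<subseteq> markov_space A \<Longrightarrow> initial_word n ` E \<subseteq> words A n"
  by (auto simp: words_def)

section \<open>Topology of the shift space\<close>

lemma compact_markov_space: "compact (markov_space A)"
proof -
  let ?N = "dim_row A"
  have "compactin (product_topology (\<lambda>i::nat. euclidean) UNIV) (PiE UNIV (\<lambda>i::nat. {..<?N}))"
    by (subst compactin_PiE) (auto intro: finite_imp_compact)
  then have "compact (PiE UNIV (\<lambda>i::nat. {..<?N}))"
    by (simp add: euclidean_product_topology)
  \<comment> \<open>Each condition on two consecutive coordinates is the preimage of a subset of a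
    discrete space, so the shift space is a closed part of a compact product of finite sets.\<close>
  moreover have "closed {x::nat \<Rightarrow> nat. \<forall>n. (x n, x (Suc n)) \<in> {(i, j). A $$ (i, j) = 1}}"
  proof (intro closed_Collect_all)
    fix n
    have "continuous_on UNIV (\<lambda>x::nat \<Rightarrow> nat. (x n, x (Suc n)))"
      by (intro continuous_on_Pair continuous_on_product_coordinates)
    moreover have "closed {(i, j). A $$ (i, j) = (1::nat)}"
      by (simp add: closed_def open_prod_def) (auto intro!: exI[of _ "{_}"] open_discrete)
    ultimately show "closed {x::nat \<Rightarrow> nat. (x n, x (Suc n)) \<in> {(i, j). A $$ (i, j) = 1}}"
      using closed_vimage[of "{(i, j). A $$ (i, j) = 1}" "\<lambda>x::nat \<Rightarrow> nat. (x n, x (Suc n))"]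
      by (simp add: vimage_def)
  qed
  ultimately have "compact (PiE UNIV (\<lambda>i::nat. {..<?N}) \<inter>
      {x::nat \<Rightarrow> nat. \<forall>n. (x n, x (Suc n)) \<in> {(i, j). A $$ (i, j) = 1}})"
    by (rule compact_Int_closed)
  moreover have "PiE UNIV (\<lambda>i::nat. {..<?N}) \<inter>
      {x::nat \<Rightarrow> nat. \<forall>n. (x n, x (Suc n)) \<in> {(i, j). A $$ (i, j) = 1}} = markov_space A"
    by (auto simp: markov_space_def)
  ultimately show ?thesis by simp
qed

lemma open_agree: "open {y :: nat \<Rightarrow> nat. \<forall>i<n. y i = x i}"
proof -
  have "{y :: nat \<Rightarrow> nat. \<forall>i<n. y i = x i} = (\<Inter>i\<in>{..<n}. (\<lambda>y. y i) -` {x i})" by auto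
  also have "open \<dots>"
    by (intro open_INT finite_lessThan ballI open_vimage open_discrete continuous_on_product_coordinates)
  finally show ?thesis .
qed

lemma openin_cylinder: "openin (top_of_set (markov_space A)) (cylinder A (initial_word n x))"
proof -
  have "cylinder A (initial_word n x) = markov_space A \<inter> {y. \<forall>i<n. y i = x i}"
    by (auto simp: cylinder_def)
  then show ?thesis using open_agree openin_open by blast
qed

lemma openin_determined_at:
  assumes "determined_at A n E" shows "openin (top_of_set (markov_space A)) E"
  by (subst determined_at_eq_UN_cylinders[OF assms]) (auto intro: openin_cylinder)

text \<open>A basic open set of the product topology constrains finitely many coordinates, and these
  all lie below some \<open>n\<close>.\<close>

lemma open_contains_agree:
  fixes U :: "(nat \<Rightarrow> nat) set"
  assumes "open U" "x \<in> U" shows "\<exists>n. {y. \<forall>i<n. y i = x i} \<subseteq> U"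
proof -
  have "openin (product_topology (\<lambda>i. euclidean) UNIV) U"
    using assms(1) by (simp add: euclidean_product_topology)
  with assms(2) obtain V :: "nat \<Rightarrow> nat set" where V: "finite {i. V i \<noteq> UNIV}"
    "x \<in> PiE UNIV V" "PiE UNIV V \<subseteq> U"
    unfolding openin_product_topology_alt by (auto simp: openin_product_topology_alt)
  have "\<exists>n. \<forall>i. V i \<noteq> UNIV \<longrightarrow> i < n"
    using V(1) finite_nat_set_iff_bounded by auto
  then obtain n where n: "\<And>i. V i \<noteq> UNIV \<Longrightarrow> i < n" by blast
  have "{y. \<forall>i<n. y i = x i} \<subseteq> PiE UNIV V"
  proof
    fix y assume "y \<in> {y. \<forall>i<n. y i = x i}"
    then have "y i \<in> V i" for i
      using V(2) n[of i] by (cases "V i = UNIV") (auto simp: PiE_iff)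
    then show "y \<in> PiE UNIV V" by auto
  qed
  with V(3) show ?thesis by blast
qed

lemma openin_contains_cylinder:
  assumes "openin (top_of_set (markov_space A)) U" "x \<in> U"
  shows "\<exists>n. cylinder A (initial_word n x) \<subseteq> U"
proof -
  from assms obtain T where T: "open T" "U = markov_space A \<inter> T" by (auto simp: openin_open)
  with assms open_contains_agree[of T x] show ?thesis by (fastforce simp: cylinder_def)
qed

text \<open>A Lebesgue number argument: by compactness finitely many cylinders with \<open>P\<close>
  cover the space, and every cylinder at least as long as all of them that meets one of them lies in
  it. It serves for clopen sets, open covers and adapted sets.\<close>

lemma uniform_level:
  assumes loc: "\<And>x. x \<in> markov_space A \<Longrightarrow> \<exists>n. P (cylinder A (initial_word n x))"
    and mono: "\<And>U V. V \<subseteq> U \<Longrightarrow> P U \<Longrightarrow> P V"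
  obtains n where "\<And>x m. x \<in> markov_space A \<Longrightarrow> n \<le> m \<Longrightarrow> P (cylinder A (initial_word m x))"
proof -
  obtain k where k: "\<And>x. x \<in> markov_space A \<Longrightarrow> P (cylinder A (initial_word (k x) x))"
    using loc by metis
  let ?C = "\<lambda>x. cylinder A (initial_word (k x) x)"
  obtain D where D: "D \<subseteq> markov_space A" "finite D" "markov_space A \<subseteq> (\<Union>x\<in>D. ?C x)"
  proof (rule compactE_image[OF compact_markov_space, of "markov_space A" "\<lambda>x. {y. \<forall>i<k x. y i = x i}" A])
    fix D assume "D \<subseteq> markov_space A" "finite D"
      "markov_space A \<subseteq> (\<Union>x\<in>D. {y. \<forall>i<k x. y i = x i})"
    then show thesis by (intro that[of D]) (auto simp: cylinder_def)
  qed (auto intro: open_agree)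
  show thesis
  proof (rule that[of "Max (insert 0 (k ` D))"])
    fix x m assume x: "x \<in> markov_space A" and m: "Max (insert 0 (k ` D)) \<le> m"
    with D obtain y where y: "y \<in> D" "x \<in> ?C y" by blast
    then have "k y \<le> m" using m D(2) by simp
    then have "cylinder A (initial_word m x) \<subseteq> ?C y"
      using y(2) by (auto simp: cylinder_def)
    with k y(1) D(1) show "P (cylinder A (initial_word m x))" using mono by blast
  qed
qed

text \<open>Both \<open>E\<close> and its complement are open, so each point has a cylinder that
  \<open>E\<close> does not split; \<open>uniform_level\<close> makes the length uniform.\<close>

lemma clopen_imp_cylindrical:
  assumes "openin (top_of_set (markov_space A)) E" "closedin (top_of_set (markov_space A)) E"
  shows "cylindrical A E"
proof -
  let ?P = "\<lambda>U. U \<subseteq> E \<or> U \<inter> E = {}"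
  have E: "E \<subseteq> markov_space A" using assms(1) openin_imp_subset by blast
  have "openin (top_of_set (markov_space A)) (markov_space A - E)"
    using assms(2) by (simp add: closedin_def)
  then have "\<exists>n. ?P (cylinder A (initial_word n x))" if "x \<in> markov_space A" for x
    using that openin_contains_cylinder[OF assms(1), of x]
      openin_contains_cylinder[of A "markov_space A - E" x] by blast
  then obtain n where n: "\<And>x m. x \<in> markov_space A \<Longrightarrow> n \<le> m \<Longrightarrow> ?P (cylinder A (initial_word m x))"
    by (rule uniform_level[of A ?P]) auto
  have "determined_at A n E"
    unfolding determined_at_def
  proof (intro conjI E ballI impI)
    fix x y assume "x \<in> E" "y \<in> markov_space A" "initial_word n y = initial_word n x"
    with n[of x n] E show "y \<in> E" by (auto simp: cylinder_initial_word)
  qed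
  then show ?thesis by (auto simp: cylindrical_def)
qed

lemma cylindrical_imp_clopen:
  assumes "cylindrical A E"
  shows "openin (top_of_set (markov_space A)) E" "closedin (top_of_set (markov_space A)) E"
proof -
  from assms obtain n where n: "determined_at A n E" by (auto simp: cylindrical_def)
  then show "openin (top_of_set (markov_space A)) E" by (rule openin_determined_at)
  from n have "determined_at A n (markov_space A - E)"
    unfolding determined_at_def by (metis DiffD1 DiffD2 DiffI Diff_subset)
  then have "openin (top_of_set (markov_space A)) (markov_space A - E)"
    by (rule openin_determined_at)
  moreover have "E \<subseteq> markov_space A" using n by (simp add: determined_at_def)
  ultimately show "closedin (top_of_set (markov_space A)) E" by (simp add: closedin_def)
qed

section \<open>Paths and points from irreducibility\<close>

lemma path_of_pow_mat:
  assumes "square_mat A" "zero_one_mat A" "i < dim_row A" "j < dim_row A" "(A ^\<^sub>m n) $$ (i, j) > 0"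
  shows "\<exists>f. f 0 = i \<and> f n = j \<and> (\<forall>k\<le>n. f k < dim_row A) \<and> (\<forall>k<n. A $$ (f k, f (Suc k)) = 1)"
  using assms(4,5)
proof (induction n arbitrary: j)
  case 0
  then have "i = j" using assms(1,3) by (auto simp: one_mat_def split: if_splits)
  then show ?case using assms(3) by (intro exI[of _ "\<lambda>_. i"]) auto
next
  case (Suc n)
  let ?N = "dim_row A"
  have A: "A \<in> carrier_mat ?N ?N" using assms(1) by auto
  have dim: "dim_col A = ?N" using assms(1) by simp
  have An: "dim_row (A ^\<^sub>m n) = ?N" "dim_col (A ^\<^sub>m n) = ?N"
    using pow_carrier_mat[OF A, of n] by auto
  have "row (A ^\<^sub>m n) i $ k = (A ^\<^sub>m n) $$ (i, k)" if "k < ?N" for k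
    using that assms(3) An by simp
  moreover have "col A j $ k = A $$ (k, j)" if "k < ?N" for k
    using index_col[of k A j] that Suc.prems(1) dim by simp
  ultimately have "(\<Sum>k<?N. row (A ^\<^sub>m n) i $ k * col A j $ k) =
      (\<Sum>k<?N. (A ^\<^sub>m n) $$ (i, k) * A $$ (k, j))" by simp
  moreover have "(A ^\<^sub>m Suc n) $$ (i, j) = row (A ^\<^sub>m n) i \<bullet> col A j"
    using Suc.prems(1) assms(3) dim An by simp
  ultimately have "(A ^\<^sub>m Suc n) $$ (i, j) = (\<Sum>k<?N. (A ^\<^sub>m n) $$ (i, k) * A $$ (k, j))"
    by (simp add: scalar_prod_def atLeast0LessThan)
  \<comment> \<open>A positive sum of naturals has a positive summand, which yields the last but one
    vertex \<open>k\<close> of the path.\<close>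
  with Suc.prems obtain k where k: "k < ?N" "(A ^\<^sub>m n) $$ (i, k) > 0" "A $$ (k, j) > 0"
    by (metis (no_types, lifting) bot_nat_0.not_eq_extremum lessThan_iff mult_is_0 sum.neutral)
  from Suc.IH[OF k(1,2)] obtain f where f: "f 0 = i" "f n = k" "\<forall>k\<le>n. f k < ?N"
    "\<forall>k<n. A $$ (f k, f (Suc k)) = 1" by blast
  have "A $$ (k, j) = 1" using assms(2) k Suc.prems by (fastforce simp: zero_one_mat_def)
  with f show ?case using Suc.prems
    by (intro exI[of _ "f(Suc n := j)"]) (auto simp: less_Suc_eq le_Suc_eq)
qed

locale markov_shift =
  fixes A :: "nat mat"
  assumes zero_one: "zero_one_mat A" and irreducible: "irreducible_mat A"
begin

abbreviation X where "X \<equiv> markov_space A"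

lemma path:
  assumes "i < dim_row A" "j < dim_row A"
  obtains n f where "n > 0" "f 0 = i" "f n = j" "\<And>k. k \<le> n \<Longrightarrow> f k < dim_row A"
    "\<And>k. k < n \<Longrightarrow> A $$ (f k, f (Suc k)) = 1"
proof -
  from irreducible assms obtain n where n: "n > 0" "(A ^\<^sub>m n) $$ (i, j) > 0"
    unfolding irreducible_mat_def by blast
  have "square_mat A" using zero_one unfolding zero_one_mat_def by blast
  from path_of_pow_mat[OF this zero_one assms n(2)] n(1) that show thesis by blast
qed

text \<open>A path from \<open>i\<close> to the first symbol of \<open>x\<close> is placed in front
  of \<open>x\<close>. Through this, irreducibility enters the positivity of cylinder
  masses.\<close>

lemma prepend_path:
  assumes "i < dim_row A" "x \<in> X"
  shows "\<exists>y\<in>X. \<exists>n. y 0 = i \<and> (shift ^^ n) y = x"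
proof -
  have "x 0 < dim_row A" using assms(2) by (auto simp: markov_space_def)
  then obtain n f where f: "n > 0" "f 0 = i" "f n = x 0" "\<And>k. k \<le> n \<Longrightarrow> f k < dim_row A"
    "\<And>k. k < n \<Longrightarrow> A $$ (f k, f (Suc k)) = 1"
    using path[OF assms(1)] by metis
  let ?y = "\<lambda>k. if k < n then f k else x (k - n)"
  have "?y \<in> X"
    unfolding markov_space_def
  proof safe
    fix k
    show "?y k < dim_row A" using assms(2) f(4)[of k] by (auto simp: markov_space_def)
    consider "Suc k < n" | "Suc k = n" | "n \<le> k" by linarith
    then show "A $$ (?y k, ?y (Suc k)) = 1"
    proof cases
      case 2
      with f(5)[of k] f(3) show ?thesis by auto
    qed (use f(5)[of k] assms(2) in \<open>auto simp: markov_space_def Suc_diff_le\<close>)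
  qed
  moreover have "?y 0 = i" "(shift ^^ n) ?y = x" using f by (auto simp: funpow_shift)
  ultimately show ?thesis by (intro bexI[of _ ?y] exI[of _ n] conjI)
qed

text \<open>Every symbol has a successor, namely the second vertex of a cycle through it; iterating
  a choice \<open>s\<close> of successors gives the point.\<close>

lemma point_above:
  assumes "i < dim_row A"
  obtains x where "x \<in> X" "x 0 = i"
proof -
  have "\<exists>j<dim_row A. A $$ (k, j) = 1" if k: "k < dim_row A" for k
  proof -
    obtain n f where f: "n > 0" "f 0 = k" "f n = k" "\<And>k. k \<le> n \<Longrightarrow> f k < dim_row A"
      "\<And>k. k < n \<Longrightarrow> A $$ (f k, f (Suc k)) = 1"
      using path[OF k k] by metis
    from f(4)[of 1] f(5)[of 0] f(1,2) show ?thesis by auto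
  qed
  then obtain s where s: "\<And>k. k < dim_row A \<Longrightarrow> s k < dim_row A \<and> A $$ (k, s k) = 1" by metis
  have *: "(s ^^ n) i < dim_row A" for n
    by (induction n) (auto simp: assms s)
  have "(\<lambda>n. (s ^^ n) i) \<in> X"
    unfolding markov_space_def using * s by auto
  then show thesis using that by force
qed

lemma dim_gt_one: "1 < dim_row A"
  using zero_one by (simp add: zero_one_mat_def)

lemma X_nonempty: "X \<noteq> {}"
  using point_above[of 0] dim_gt_one by force

end

section \<open>Conformal measures\<close>

lemma cylindrical_empty: "cylindrical A {}"
  by (auto simp: cylindrical_def determined_at_def)

lemma cylindrical_whole: "cylindrical A (markov_space A)"
  by (auto simp: cylindrical_def determined_at_def)

lemma cylinder_initial_word_Suc:
  "cylinder A (initial_word (Suc n) x) =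
    {y \<in> markov_space A. y 0 = x 0 \<and> initial_word n (shift y) = initial_word n (shift x)}"
  unfolding cylinder_initial_word by (simp add: initial_word_Suc)

lemma shift_image_cylinder:
  assumes "x \<in> markov_space A" "n > 0"
  shows "shift ` cylinder A (initial_word (Suc n) x) = cylinder A (initial_word n (shift x))"
proof (intro equalityI subsetI)
  fix y assume "y \<in> shift ` cylinder A (initial_word (Suc n) x)"
  then show "y \<in> cylinder A (initial_word n (shift x))"
    by (auto simp: cylinder_initial_word_Suc cylinder_initial_word[of A n] intro: shift_in_markov_space)
next
  fix y assume y: "y \<in> cylinder A (initial_word n (shift x))"
  \<comment> \<open>Prepending \<open>x 0\<close> to \<open>y\<close> is allowed because
    \<open>y 0 = x 1\<close>, and this equality is where \<open>n > 0\<close> enters.\<close>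
  let ?z = "case_nat (x 0) y"
  have "y 0 = x 1" "y \<in> markov_space A"
    using y assms(2) by (auto simp: cylinder_def shift_def)
  then have "?z \<in> markov_space A"
    using assms(1) by (auto simp: markov_space_def split: nat.split)
  moreover have "shift ?z = y" by (auto simp: shift_def)
  ultimately have "?z \<in> cylinder A (initial_word (Suc n) x)" "y = shift ?z"
    using y by (auto simp: cylinder_initial_word_Suc cylinder_initial_word[of A n])
  then show "y \<in> shift ` cylinder A (initial_word (Suc n) x)" by blast
qed

lemma inj_on_shift: "inj_on shift {x. x 0 = i}"
proof (rule inj_onI)
  fix x y :: "nat \<Rightarrow> nat" assume "x \<in> {x. x 0 = i}" "y \<in> {x. x 0 = i}" "shift x = shift y"
  then have "x k = y k" for k by (cases k) (auto simp: shift_def fun_eq_iff)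
  then show "x = y" by blast
qed

lemma disjoint_cylinders: "disjoint_family_on (cylinder A) (words A n)"
  by (auto simp: disjoint_family_on_def cylinder_word)

text \<open>The values of \<open>m\<close> matter on cylindrical sets only.\<close>

locale conformal_measure = markov_shift +
  fixes m :: "(nat \<Rightarrow> nat) set \<Rightarrow> real" and r :: real
  assumes r_pos: "r > 0"
    and m_nonneg: "cylindrical A E \<Longrightarrow> 0 \<le> m E"
    and m_Un: "\<lbrakk>cylindrical A E; cylindrical A F; E \<inter> F = {}\<rbrakk> \<Longrightarrow> m (E \<union> F) = m E + m F"
    and m_space: "m (markov_space A) = 1"
    and m_cylinder_shift: "\<lbrakk>x \<in> markov_space A; n > 0\<rbrakk> \<Longrightarrow>
      m (cylinder A (initial_word n (shift x))) = r * m (cylinder A (initial_word (Suc n) x))"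
begin

lemma m_empty: "m {} = 0"
  using m_Un[of "{}" "{}"] cylindrical_empty by simp

lemma m_UN:
  assumes "finite I" "\<And>i. i \<in> I \<Longrightarrow> cylindrical A (E i)" "disjoint_family_on E I"
  shows "m (\<Union>i\<in>I. E i) = (\<Sum>i\<in>I. m (E i))"
  using assms
proof (induction I rule: finite_induct)
  case empty
  show ?case by (simp add: m_empty)
next
  case (insert a I)
  have "E a \<inter> (\<Union>i\<in>I. E i) = {}"
    using insert.prems(2) insert.hyps(2) by (fastforce simp: disjoint_family_on_def)
  moreover have "cylindrical A (\<Union>i\<in>I. E i)"
    using insert by (intro cylindrical_UN) auto
  ultimately have "m (E a \<union> (\<Union>i\<in>I. E i)) = m (E a) + m (\<Union>i\<in>I. E i)"
    using insert.prems(1) by (intro m_Un) auto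
  moreover have "disjoint_family_on E I"
    using insert.prems(2) by (auto simp: disjoint_family_on_def)
  ultimately show ?case using insert by simp
qed

lemma m_determined_at:
  assumes "determined_at A n E"
  shows "m E = (\<Sum>w\<in>initial_word n ` E. m (cylinder A w))"
proof -
  have sub: "initial_word n ` E \<subseteq> words A n"
    using assms by (intro initial_word_image_subset_words) (simp add: determined_at_def)
  have "m (\<Union>w\<in>initial_word n ` E. cylinder A w) = (\<Sum>w\<in>initial_word n ` E. m (cylinder A w))"
  proof (rule m_UN)
    show "finite (initial_word n ` E)" using sub finite_words finite_subset by blast
    show "disjoint_family_on (cylinder A) (initial_word n ` E)"
      using disjoint_family_on_mono[OF sub disjoint_cylinders] .
  qed (use sub cylindrical_cylinder in blast)
  then show ?thesis using determined_at_eq_UN_cylinders[OF assms] by simp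
qed

lemma m_mono:
  assumes "cylindrical A E" "cylindrical A F" "E \<subseteq> F" shows "m E \<le> m F"
proof -
  obtain n k where n: "determined_at A n E" "determined_at A k F"
    using assms unfolding cylindrical_def by blast
  have E: "determined_at A (max n k) E" and F: "determined_at A (max n k) F"
    using n by (auto intro: determined_at_mono)
  have FW: "initial_word (max n k) ` F \<subseteq> words A (max n k)"
    using F by (intro initial_word_image_subset_words) (simp add: determined_at_def)
  show ?thesis
    unfolding m_determined_at[OF E] m_determined_at[OF F]
    using FW assms(3)
    by (intro sum_mono2 finite_subset[OF FW] finite_words m_nonneg cylindrical_cylinder) auto
qed

text \<open>Extends the scaling rule from cylinders to cylindrical sets with a fixed first symbol:
  \<open>shift\<close> is injective there, so a decomposition into cylinders has disjoint
  images.\<close>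

lemma m_shift:
  assumes "cylindrical A D" "D \<subseteq> {x. x 0 = i}"
  shows "cylindrical A (shift ` D) \<and> m (shift ` D) = r * m D"
proof -
  obtain k where "determined_at A k D" using assms(1) by (auto simp: cylindrical_def)
  \<comment> \<open>Length at least two leaves a nonempty word after one shift, as
    \<open>m_cylinder_shift\<close> demands.\<close>
  then have D: "determined_at A (Suc (Suc k)) D" by (rule determined_at_mono) simp
  let ?I = "initial_word (Suc (Suc k)) ` D"
  have DX: "D \<subseteq> X" using D by (simp add: determined_at_def)
  have fin: "finite ?I"
    by (rule finite_subset[OF initial_word_image_subset_words[OF DX] finite_words])
  have eq: "D = (\<Union>w\<in>?I. cylinder A w)" by (rule determined_at_eq_UN_cylinders[OF D])
  have img: "\<exists>x\<in>X. shift ` cylinder A w = cylinder A (initial_word (Suc k) (shift x)) \<and>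
      m (shift ` cylinder A w) = r * m (cylinder A w)" if "w \<in> ?I" for w
  proof -
    from that DX obtain x where x: "x \<in> X" "w = initial_word (Suc (Suc k)) x" by blast
    then show ?thesis
      using shift_image_cylinder[of x A "Suc k"] m_cylinder_shift[of x "Suc k"] by auto
  qed
  have cyl: "cylindrical A (shift ` cylinder A w)" if "w \<in> ?I" for w
    using img[OF that] determined_at_cylinder unfolding cylindrical_def by metis
  have shD: "shift ` D = (\<Union>w\<in>?I. shift ` cylinder A w)"
    by (subst (1) eq) blast
  have "disjoint_family_on (\<lambda>w. shift ` cylinder A w) ?I"
    unfolding disjoint_family_on_def
  proof (intro ballI impI)
    fix v w assume vw: "v \<in> ?I" "w \<in> ?I" "v \<noteq> w"
    have "cylinder A v \<inter> cylinder A w = {}"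
      using vw disjoint_cylinders initial_word_image_subset_words[OF DX]
      unfolding disjoint_family_on_def by blast
    moreover have "cylinder A v \<subseteq> {x. x 0 = i}" "cylinder A w \<subseteq> {x. x 0 = i}"
      using vw eq assms(2) by blast+
    ultimately show "shift ` cylinder A v \<inter> shift ` cylinder A w = {}"
      using inj_on_image_Int[OF inj_on_shift[of i], of "cylinder A v" "cylinder A w"] by simp
  qed
  then have "m (shift ` D) = (\<Sum>w\<in>?I. m (shift ` cylinder A w))"
    unfolding shD by (intro m_UN fin cyl)
  also have "\<dots> = (\<Sum>w\<in>?I. r * m (cylinder A w))"
    by (rule sum.cong) (use img in auto)
  also have "\<dots> = r * m D"
    unfolding m_determined_at[OF D] by (simp add: sum_distrib_left)
  finally show ?thesis
    unfolding shD using cylindrical_UN[OF fin cyl] by simp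
qed

text \<open>The first \<open>l\<close> symbols are constant on \<open>D\<close>, so each of the
  \<open>l\<close> shifts acts on a set with a single first symbol and \<open>m_shift\<close>
  applies.\<close>

lemma m_funpow_shift:
  assumes "cylindrical A D" "D \<subseteq> cylinder A (initial_word l x)"
  shows "m ((shift ^^ l) ` D) = r ^ l * m D"
  using assms
proof (induction l arbitrary: D x)
  case 0
  then show ?case by simp
next
  case (Suc l)
  have *: "cylindrical A (shift ` D)" "m (shift ` D) = r * m D"
    using m_shift[of D "x 0"] Suc.prems by (auto simp: cylinder_initial_word_Suc)
  have "shift ` D \<subseteq> cylinder A (initial_word l (shift x))"
    using Suc.prems(2) by (auto simp: cylinder_initial_word_Suc cylinder_initial_word[of A l] intro: shift_in_markov_space)
  then have "m ((shift ^^ l) ` (shift ` D)) = r ^ l * m (shift ` D)"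
    by (intro Suc.IH[OF *(1)])
  then show ?case
    by (simp only: funpow_Suc_right image_comp *(2) power_Suc) (simp add: mult_ac)
qed

lemma m_cylinder_funpow_shift:
  assumes "x \<in> X" "n > 0"
  shows "m (cylinder A (initial_word n ((shift ^^ k) x))) = r ^ k * m (cylinder A (initial_word (k + n) x))"
  using assms(1)
proof (induction k arbitrary: x)
  case (Suc k)
  have "m (cylinder A (initial_word n ((shift ^^ k) (shift x)))) =
      r ^ k * m (cylinder A (initial_word (k + n) (shift x)))"
    by (rule Suc.IH) (rule shift_in_markov_space[OF Suc.prems])
  then show ?case
    using m_cylinder_shift[of x "k + n"] Suc.prems assms(2)
    by (simp add: funpow_Suc_right del: funpow.simps)
qed simp

lemma sum_m_cylinders: "(\<Sum>w\<in>words A n. m (cylinder A w)) = 1"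
proof -
  have "determined_at A n X" by (simp add: determined_at_def)
  from m_determined_at[OF this] show ?thesis by (simp add: m_space words_def)
qed

text \<open>Total mass one makes some one-letter cylinder positive. Irreducibility spreads
  positivity to all one-letter cylinders, and the scaling rule carries it to longer ones.\<close>

lemma m_cylinder_pos:
  assumes "x \<in> X" shows "0 < m (cylinder A (initial_word n x))"
proof -
  have "\<exists>w\<in>words A 1. 0 < m (cylinder A w)"
  proof (rule ccontr)
    assume "\<not> ?thesis"
    then have "(\<Sum>w\<in>words A 1. m (cylinder A w)) \<le> 0" by (intro sum_nonpos) force
    then show False by (simp add: sum_m_cylinders)
  qed
  then obtain z where z: "z \<in> X" "0 < m (cylinder A (initial_word 1 z))"
    by (auto simp: words_def)
  have one: "0 < m (cylinder A (initial_word 1 y))" if y: "y \<in> X" for y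
  proof -
    have "y 0 < dim_row A" using y by (auto simp: markov_space_def)
    \<comment> \<open>\<open>u\<close> starts with \<open>y 0\<close> and becomes \<open>z\<close>
      after \<open>k\<close> shifts. By scaling, its cylinder of length \<open>k + 1\<close> has
      positive mass, and it lies in the one-letter cylinder of \<open>y\<close>.\<close>
    from prepend_path[OF this z(1)] obtain u k where u: "u \<in> X" "u 0 = y 0" "(shift ^^ k) u = z"
      by blast
    have "0 < r ^ k * m (cylinder A (initial_word (k + 1) u))"
      using m_cylinder_funpow_shift[OF u(1), of 1 k] z(2) u(3) by simp
    then have "0 < m (cylinder A (initial_word (k + 1) u))"
      using r_pos by (simp add: zero_less_mult_iff)
    also have "\<dots> \<le> m (cylinder A (initial_word 1 y))"
      using u(1,2) y
      by (intro m_mono cylindrical_cylinder[of _ A "k + 1"] cylindrical_cylinder[of _ A 1])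
        (auto simp: words_def cylinder_def)
    finally show ?thesis .
  qed
  show ?thesis
  proof (cases n)
    case 0
    then show ?thesis by (simp add: cylinder_def m_space)
  next
    case (Suc k)
    have "0 < r ^ k * m (cylinder A (initial_word (k + 1) x))"
      using m_cylinder_funpow_shift[OF assms, of 1 k]
        one[OF funpow_shift_in_markov_space[OF assms, of k]] by simp
    then show ?thesis using r_pos Suc by (simp add: zero_less_mult_iff)
  qed
qed

lemma m_pos:
  assumes "cylindrical A E" "E \<noteq> {}" shows "0 < m E"
proof -
  obtain n where n: "determined_at A n E" using assms(1) by (auto simp: cylindrical_def)
  obtain x where x: "x \<in> E" using assms(2) by blast
  then have "x \<in> X" "cylinder A (initial_word n x) \<subseteq> E"
    using n by (auto simp: determined_at_def cylinder_initial_word)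
  then have "m (cylinder A (initial_word n x)) \<le> m E"
    by (intro m_mono assms(1)) (auto simp: cylindrical_def intro: determined_at_cylinder)
  with m_cylinder_pos[OF \<open>x \<in> X\<close>, of n] show ?thesis by linarith
qed

text \<open>After \<open>n\<close> shifts the cylinder of a word of length \<open>n + 1\<close>
  becomes that of its last symbol, so \<open>r ^ n\<close> times its mass lies between a positive
  constant and one. The masses of all words add up to one, so summation counts the words.\<close>

lemma card_words_bounds:
  obtains C where "C > 0" "\<And>n. r ^ n \<le> real (card (words A (Suc n)))"
    "\<And>n. real (card (words A (Suc n))) \<le> C * r ^ n"
proof -
  \<comment> \<open>The smallest mass of a one-letter cylinder, positive because there are finitely
    many.\<close>
  define d where "d = Min ((\<lambda>w. m (cylinder A w)) ` words A 1)"
  have ne: "words A 1 \<noteq> {}" using X_nonempty by (simp add: words_def)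
  have "d \<in> (\<lambda>w. m (cylinder A w)) ` words A 1"
    unfolding d_def using ne finite_words by (intro Min_in) auto
  then have d: "d > 0" using m_cylinder_pos by (auto simp: words_def)
  have bounds: "d \<le> r ^ n * m (cylinder A w) \<and> r ^ n * m (cylinder A w) \<le> 1"
    if "w \<in> words A (Suc n)" for w n
  proof -
    from that obtain x where x: "x \<in> X" "w = initial_word (Suc n) x" by (auto simp: words_def)
    let ?v = "initial_word 1 ((shift ^^ n) x)"
    have v: "?v \<in> words A 1" using funpow_shift_in_markov_space[OF x(1)] by (auto simp: words_def)
    have "r ^ n * m (cylinder A w) = m (cylinder A ?v)"
      using m_cylinder_funpow_shift[OF x(1), of 1 n] x(2) by simp
    moreover have "d \<le> m (cylinder A ?v)"
      unfolding d_def using v finite_words by (intro Min_le) auto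
    moreover have "m (cylinder A ?v) \<le> m X"
      using v by (intro m_mono cylindrical_cylinder cylindrical_whole) (auto simp: cylinder_def)
    ultimately show ?thesis by (simp add: m_space)
  qed
  have rn: "(\<Sum>w\<in>words A (Suc n). r ^ n * m (cylinder A w)) = r ^ n" for n
    by (simp add: sum_distrib_left[symmetric] sum_m_cylinders)
  show thesis
  proof (rule that[of "1 / d"])
    show "1 / d > 0" using d by simp
    show "r ^ n \<le> real (card (words A (Suc n)))" for n
      using sum_mono[of "words A (Suc n)" "\<lambda>w. r ^ n * m (cylinder A w)" "\<lambda>_. 1"] bounds
      by (simp add: rn)
    show "real (card (words A (Suc n))) \<le> 1 / d * r ^ n" for n
      using sum_mono[of "words A (Suc n)" "\<lambda>_. d" "\<lambda>w. r ^ n * m (cylinder A w)"] bounds d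
      by (simp add: rn field_simps)
  qed
qed

end

section \<open>Topological entropy\<close>

text \<open>Fekete's subadditive lemma. The limit is the infimum over positive \<open>n\<close>,
  finite by nonnegativity; dividing \<open>n\<close> with remainder by a nearly optimal
  \<open>p\<close> gives the upper bound.\<close>

lemma fekete:
  fixes a :: "nat \<Rightarrow> real"
  assumes nonneg: "\<And>n. 0 \<le> a n" and sub: "\<And>m n. a (m + n) \<le> a m + a n"
  shows "convergent (\<lambda>n. a n / real n)"
proof -
  define L where "L = (INF n\<in>{1..}. a n / real n)"
  have bdd: "bdd_below ((\<lambda>n. a n / real n) ` {1..})"
    by (rule bdd_belowI[of _ 0]) (auto simp: nonneg)
  have mult: "a (q * p + s) \<le> real q * a p + a s" for p q s
  proof (induction q)
    case (Suc q)
    have "a (Suc q * p + s) \<le> a p + a (q * p + s)"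
      using sub[of p "q * p + s"] by (simp add: add_ac)
    with Suc show ?case by (simp add: algebra_simps)
  qed simp
  have "(\<lambda>n. a n / real n) \<longlonglongrightarrow> L"
  proof (rule LIMSEQ_I)
    fix e :: real assume e: "0 < e"
    have "(INF n\<in>{1..}. a n / real n) < L + e / 2" using e by (simp add: L_def)
    then obtain p where p: "p \<ge> 1" "a p / real p < L + e / 2"
      using cINF_less_iff[OF _ bdd] by auto
    \<comment> \<open>\<open>M\<close> bounds \<open>a\<close> at every remainder modulo
      \<open>p\<close>, leaving an error \<open>M / n\<close> that tends to zero.\<close>
    define M where "M = (\<Sum>s<p. a s)"
    obtain n0 where n0: "2 * M / e < real n0" using reals_Archimedean2 by blast
    show "\<exists>no. \<forall>n\<ge>no. norm (a n / real n - L) < e"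
    proof (intro exI allI impI)
      fix n assume n: "Suc n0 \<le> n"
      have "L \<le> a n / real n" unfolding L_def by (rule cINF_lower[OF bdd]) (use n in auto)
      moreover have "a n / real n < L + e"
      proof -
        have "a (n mod p) \<le> M"
          unfolding M_def using p(1) by (intro member_le_sum) (auto simp: nonneg)
        then have "a n \<le> real (n div p) * a p + M"
          using mult[of "n div p" p "n mod p"] by simp
        also have "real (n div p) * a p \<le> real n / real p * a p"
          using p(1) by (intro mult_right_mono nonneg of_nat_div_le_of_nat)
        finally have "a n / real n \<le> (real n / real p * a p + M) / real n"
          by (simp add: divide_right_mono)
        also have "\<dots> = a p / real p + M / real n"
          using n by (simp add: field_simps)
        also have "M / real n < e / 2"
        proof -
          have "2 * M / e < real n" using n0 n by linarith
          then show ?thesis using e n by (simp add: field_simps)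
        qed
        finally show ?thesis using p(2) by linarith
      qed
      ultimately show "norm (a n / real n - L) < e" by simp
    qed
  qed
  then show ?thesis by (auto simp: convergent_def)
qed

section \<open>Subcovers of iterated joins\<close>

lemma min_subcover_card_le:
  assumes "\<V> \<subseteq> \<W>" "finite \<V>" "\<Union>\<V> = X"
  shows "min_subcover_card X \<W> \<le> card \<V>"
  unfolding min_subcover_card_def using assms by (intro Least_le) blast

lemma min_subcover_card_attained:
  assumes "\<V> \<subseteq> \<W>" "finite \<V>" "\<Union>\<V> = X"
  obtains \<V>' where "\<V>' \<subseteq> \<W>" "finite \<V>'" "card \<V>' = min_subcover_card X \<W>" "\<Union>\<V>' = X"
proof -
  have "\<exists>\<V>'\<subseteq>\<W>. finite \<V>' \<and> card \<V>' = min_subcover_card X \<W> \<and> \<Union>\<V>' = X"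
    unfolding min_subcover_card_def
    by (rule LeastI[of "\<lambda>m. \<exists>\<V>'\<subseteq>\<W>. finite \<V>' \<and> card \<V>' = m \<and> \<Union>\<V>' = X" "card \<V>"])
      (use assms in blast)
  then show thesis using that by blast
qed

lemma all_less_add_iff:
  "(\<forall>i<n + k. P i) \<longleftrightarrow> (\<forall>i<n. P i) \<and> (\<forall>i<k. P (n + i))" for n k :: nat
proof (intro iffI conjI allI impI)
  fix i assume P: "(\<forall>i<n. P i) \<and> (\<forall>i<k. P (n + i))" and i: "i < n + k"
  show "P i"
  proof (cases "i < n")
    case False
    then obtain j where "i = n + j" using le_Suc_ex by (metis not_less)
    with P i show ?thesis by simp
  qed (use P in simp)
qed auto

lemma iterated_join_add:
  assumes P: "P \<in> iterated_join X T \<U> n" and Q: "Q \<in> iterated_join X T \<U> k"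
    and T: "\<And>x. x \<in> X \<Longrightarrow> T x \<in> X"
  shows "{x \<in> P. (T ^^ n) x \<in> Q} \<in> iterated_join X T \<U> (n + k)"
proof -
  obtain U V where U: "\<forall>i<n. U i \<in> \<U>" "P = {x \<in> X. \<forall>i<n. (T ^^ i) x \<in> U i}"
    and V: "\<forall>i<k. V i \<in> \<U>" "Q = {x \<in> X. \<forall>i<k. (T ^^ i) x \<in> V i}"
    using P Q unfolding iterated_join_def by blast
  \<comment> \<open>The joint choice follows \<open>U\<close> at the first \<open>n\<close> times
    and then \<open>V\<close>, delayed by \<open>n\<close>.\<close>
  let ?W = "\<lambda>i. if i < n then U i else V (i - n)"
  have TX: "(T ^^ i) x \<in> X" if "x \<in> X" for i x
    using that by (induction i) (auto intro: T)
  have split: "(\<forall>i<n + k. (T ^^ i) x \<in> ?W i) \<longleftrightarrow>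
      (\<forall>i<n. (T ^^ i) x \<in> U i) \<and> (\<forall>i<k. (T ^^ i) ((T ^^ n) x) \<in> V i)" for x
  proof -
    have "(T ^^ i) ((T ^^ n) x) = (T ^^ (n + i)) x" for i
      by (simp add: funpow_add add.commute[of n])
    moreover have "(\<forall>i<n + k. (T ^^ i) x \<in> ?W i) \<longleftrightarrow>
        (\<forall>i<n. (T ^^ i) x \<in> ?W i) \<and> (\<forall>i<k. (T ^^ (n + i)) x \<in> ?W (n + i))"
      by (rule all_less_add_iff)
    ultimately show ?thesis by simp
  qed
  have "{x \<in> P. (T ^^ n) x \<in> Q} = {x \<in> X. \<forall>i<n + k. (T ^^ i) x \<in> ?W i}"
    unfolding U(2) V(2) split using TX by auto
  moreover have "\<forall>i<n + k. ?W i \<in> \<U>" using U(1) V(1) by auto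
  ultimately show ?thesis unfolding iterated_join_def
    by (intro CollectI exI[of _ ?W] conjI)
qed

text \<open>Pairs of members of optimal subcovers for \<open>n\<close> and \<open>k\<close> form a
  subcover for \<open>n + k\<close>. By \<open>fin\<close> the \<open>LEAST\<close> in
  \<open>min_subcover_card\<close> is attained.\<close>

lemma min_subcover_card_iterated_join_add:
  assumes T: "\<And>x. x \<in> X \<Longrightarrow> T x \<in> X"
    and fin: "\<And>n. \<exists>\<V>\<subseteq>iterated_join X T \<U> n. finite \<V> \<and> \<Union>\<V> = X"
  shows "min_subcover_card X (iterated_join X T \<U> (n + k)) \<le>
    min_subcover_card X (iterated_join X T \<U> n) * min_subcover_card X (iterated_join X T \<U> k)"
proof -
  obtain \<V> where V: "\<V> \<subseteq> iterated_join X T \<U> n" "finite \<V>"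
    "card \<V> = min_subcover_card X (iterated_join X T \<U> n)" "\<Union>\<V> = X"
    using fin[of n] min_subcover_card_attained by metis
  obtain \<W> where W: "\<W> \<subseteq> iterated_join X T \<U> k" "finite \<W>"
    "card \<W> = min_subcover_card X (iterated_join X T \<U> k)" "\<Union>\<W> = X"
    using fin[of k] min_subcover_card_attained by metis
  have TX: "(T ^^ i) x \<in> X" if "x \<in> X" for i x
    using that by (induction i) (auto intro: T)
  let ?f = "\<lambda>(P, Q). {x \<in> P. (T ^^ n) x \<in> Q}"
  have "\<Union>(?f ` (\<V> \<times> \<W>)) = X"
  proof (intro equalityI subsetI)
    fix x assume x: "x \<in> X"
    then obtain P Q where "P \<in> \<V>" "x \<in> P" "Q \<in> \<W>" "(T ^^ n) x \<in> Q"
      using V(4) W(4) TX[OF x, of n] by blast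
    then show "x \<in> \<Union>(?f ` (\<V> \<times> \<W>))" by auto
  qed (use V(4) in auto)
  then have "min_subcover_card X (iterated_join X T \<U> (n + k)) \<le> card (?f ` (\<V> \<times> \<W>))"
  proof (intro min_subcover_card_le)
    show "?f ` (\<V> \<times> \<W>) \<subseteq> iterated_join X T \<U> (n + k)"
    proof safe
      fix P Q assume "P \<in> \<V>" "Q \<in> \<W>"
      then show "{x \<in> P. (T ^^ n) x \<in> Q} \<in> iterated_join X T \<U> (n + k)"
        using V(1) W(1) by (intro iterated_join_add T) auto
    qed
  qed (use V(2) W(2) in simp)
  also have "\<dots> \<le> card (\<V> \<times> \<W>)" by (rule card_image_le) (use V W in simp)
  finally show ?thesis using V(3) W(3) by (simp add: card_cartesian_product)
qed

text \<open>The first \<open>n + p\<close> symbols of a point determine, for each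
  \<open>k < n\<close>, the cylinder of length \<open>p\<close> around its \<open>k\<close>-th
  shift, hence a member of the cover. One member of the join per word therefore suffices.\<close>

lemma iterated_join_subcover_words:
  assumes p: "\<And>x. x \<in> markov_space A \<Longrightarrow> \<exists>V\<in>\<U>. cylinder A (initial_word p x) \<subseteq> V"
  shows "\<exists>\<V>\<subseteq>iterated_join (markov_space A) shift \<U> n.
    finite \<V> \<and> \<Union>\<V> = markov_space A \<and> card \<V> \<le> card (words A (n + p))"
proof -
  obtain V where V: "\<And>x. x \<in> markov_space A \<Longrightarrow> V x \<in> \<U> \<and> cylinder A (initial_word p x) \<subseteq> V x"
    using p by metis
  have "\<exists>x\<in>markov_space A. initial_word (n + p) x = w" if "w \<in> words A (n + p)" for w
    using that by (auto simp: words_def)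
  then obtain z where z: "\<And>w. w \<in> words A (n + p) \<Longrightarrow> z w \<in> markov_space A"
    "\<And>w. w \<in> words A (n + p) \<Longrightarrow> initial_word (n + p) (z w) = w" by metis
  \<comment> \<open>The members of the cover are selected along the orbit of the representative
    \<open>z w\<close> of the word \<open>w\<close>.\<close>
  let ?J = "\<lambda>w. {y \<in> markov_space A. \<forall>k<n. (shift ^^ k) y \<in> V ((shift ^^ k) (z w))}"
  have "?J w \<in> iterated_join (markov_space A) shift \<U> n" if "w \<in> words A (n + p)" for w
    unfolding iterated_join_def
    by (intro CollectI exI[of _ "\<lambda>k. V ((shift ^^ k) (z w))"] conjI refl allI impI
        conjunct1[OF V] funpow_shift_in_markov_space z(1) that)
  moreover have "\<Union>(?J ` words A (n + p)) = markov_space A"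
  proof (intro equalityI subsetI)
    fix y assume y: "y \<in> markov_space A"
    define w where "w = initial_word (n + p) y"
    have w: "w \<in> words A (n + p)" using y by (auto simp: words_def w_def)
    have agree: "\<forall>i<n + p. z w i = y i"
      using z(2)[OF w] by (simp add: w_def initial_word_eq_iff)
    have "(shift ^^ k) y \<in> V ((shift ^^ k) (z w))" if "k < n" for k
    proof -
      have "(shift ^^ k) y \<in> cylinder A (initial_word p ((shift ^^ k) (z w)))"
        using that agree funpow_shift_in_markov_space[OF y, of k]
        by (auto simp: cylinder_initial_word initial_word_eq_iff funpow_shift)
      then show ?thesis using V[OF funpow_shift_in_markov_space[OF z(1)[OF w]], of k] by blast
    qed
    with y w show "y \<in> \<Union>(?J ` words A (n + p))" by blast
  qed auto
  ultimately show ?thesis using finite_words card_image_le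
    by (intro exI[of _ "?J ` words A (n + p)"]) blast
qed

text \<open>For the cover by first symbols, a member of the join fixes the first \<open>n\<close>
  symbols and so meets at most one word; a subcover needs at least as many members as there are
  words.\<close>

lemma card_words_le_min_subcover_card:
  assumes fin: "\<exists>\<V>\<subseteq>iterated_join (markov_space A) shift (range (\<lambda>j. {x \<in> markov_space A. x 0 = j})) n.
      finite \<V> \<and> \<Union>\<V> = markov_space A"
  shows "card (words A n) \<le>
    min_subcover_card (markov_space A) (iterated_join (markov_space A) shift (range (\<lambda>j. {x \<in> markov_space A. x 0 = j})) n)"
    (is "_ \<le> min_subcover_card _ ?W")
proof -
  from fin obtain \<V>\<^sub>0 where "\<V>\<^sub>0 \<subseteq> ?W" "finite \<V>\<^sub>0" "\<Union>\<V>\<^sub>0 = markov_space A" by (elim exE conjE)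
  then obtain \<V> where V: "\<V> \<subseteq> ?W" "finite \<V>" "card \<V> = min_subcover_card (markov_space A) ?W"
    "\<Union>\<V> = markov_space A"
    by (rule min_subcover_card_attained)
  have one: "finite (initial_word n ` P) \<and> card (initial_word n ` P) \<le> 1" if P: "P \<in> \<V>" for P
  proof -
    from P V(1) obtain U where U: "\<And>k. k < n \<Longrightarrow> U k \<in> range (\<lambda>j. {x \<in> markov_space A. x 0 = j})"
      "P = {x \<in> markov_space A. \<forall>k<n. (shift ^^ k) x \<in> U k}"
      unfolding iterated_join_def by blast
    have "x k = y k" if "x \<in> P" "y \<in> P" "k < n" for x y k
    proof -
      have "(shift ^^ k) x \<in> U k" "(shift ^^ k) y \<in> U k" using that U(2) by blast+
      with U(1)[OF that(3)] have "(shift ^^ k) x 0 = (shift ^^ k) y 0" by auto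
      then show ?thesis by (simp add: funpow_shift)
    qed
    then have "initial_word n x = initial_word n y" if "x \<in> P" "y \<in> P" for x y
      using that by (simp add: initial_word_eq_iff)
    then have "initial_word n ` P \<subseteq> {initial_word n (SOME x. x \<in> P)}"
      using someI[of "\<lambda>x. x \<in> P"] by blast
    from card_mono[OF _ this] finite_subset[OF this] show ?thesis by simp
  qed
  have "words A n = (\<Union>P\<in>\<V>. initial_word n ` P)" unfolding words_def V(4)[symmetric] by (rule image_Union)
  also have "card \<dots> \<le> (\<Sum>P\<in>\<V>. card (initial_word n ` P))" by (rule card_UN_le[OF V(2)])
  also have "\<dots> \<le> (\<Sum>P\<in>\<V>. 1)" by (rule sum_mono) (use one in blast)
  finally show ?thesis using V(3) by simp
qed

section \<open>Entropy from a conformal measure\<close>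

context conformal_measure
begin

lemma open_cover_level:
  assumes "open_cover X \<U>"
  shows "\<exists>p>0. \<forall>x\<in>X. \<exists>V\<in>\<U>. cylinder A (initial_word p x) \<subseteq> V"
proof -
  have "\<exists>n. \<exists>V\<in>\<U>. cylinder A (initial_word n x) \<subseteq> V" if "x \<in> X" for x
  proof -
    from assms that obtain V where "V \<in> \<U>" "x \<in> V" "openin (top_of_set X) V"
      unfolding open_cover_def by blast
    then show ?thesis using openin_contains_cylinder[of A V x] by blast
  qed
  then obtain p where "\<And>x m. x \<in> X \<Longrightarrow> p \<le> m \<Longrightarrow> \<exists>V\<in>\<U>. cylinder A (initial_word m x) \<subseteq> V"
    by (rule uniform_level[of A "\<lambda>E. \<exists>V\<in>\<U>. E \<subseteq> V"]) blast+
  \<comment> \<open>The length is made positive because \<open>card_words_bounds\<close> counts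
    words of length \<open>Suc n\<close>.\<close>
  then show ?thesis by (intro exI[of _ "Suc p"]) auto
qed

text \<open>Submultiplicativity makes the logarithms subadditive, so \<open>fekete\<close> gives the
  limit; the number of words of length \<open>n + p\<close> bounds it by
  \<open>ln r\<close>.\<close>

lemma cover_entropy_sandwich:
  assumes "open_cover X \<U>"
  obtains L where "cover_entropy X shift \<U> = ereal L" "L \<le> ln r"
    "(\<lambda>n. 1 / real n * ln (real (min_subcover_card X (iterated_join X shift \<U> n)))) \<longlonglongrightarrow> L"
proof -
  obtain p where p: "p > 0" "\<And>x. x \<in> X \<Longrightarrow> \<exists>V\<in>\<U>. cylinder A (initial_word p x) \<subseteq> V"
    using open_cover_level[OF assms] by metis
  define N where "N n = min_subcover_card X (iterated_join X shift \<U> n)" for n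
  have sub: "\<exists>\<V>\<subseteq>iterated_join X shift \<U> n. finite \<V> \<and> \<Union>\<V> = X \<and> card \<V> \<le> card (words A (n + p))" for n
    by (rule iterated_join_subcover_words[OF p(2)])
  then have fin: "\<exists>\<V>\<subseteq>iterated_join X shift \<U> n. finite \<V> \<and> \<Union>\<V> = X" for n by meson
  \<comment> \<open>The space is not empty, so a subcover has at least one member and the logarithm
    of its size is nonnegative.\<close>
  have N_pos: "N n > 0" for n
  proof -
    obtain \<V> where "finite \<V>" "card \<V> = N n" "\<Union>\<V> = X"
      unfolding N_def using fin[of n] min_subcover_card_attained by metis
    then show ?thesis using X_nonempty by (metis Union_empty card_gt_0_iff)
  qed
  have N_le: "N n \<le> card (words A (n + p))" for n
    using sub[of n] unfolding N_def by (elim exE conjE) (rule order_trans[OF min_subcover_card_le])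
  have N_add: "N (n + k) \<le> N n * N k" for n k
    unfolding N_def by (intro min_subcover_card_iterated_join_add fin shift_in_markov_space)
  have "convergent (\<lambda>n. ln (real (N n)) / real n)"
  proof (rule fekete)
    show "0 \<le> ln (real (N n))" for n using N_pos[of n] by simp
    show "ln (real (N (n + k))) \<le> ln (real (N n)) + ln (real (N k))" for n k
    proof -
      have "ln (real (N (n + k))) \<le> ln (real (N n) * real (N k))"
        using N_add[of n k] N_pos[of "n + k"] by (subst ln_le_cancel_iff) (auto simp: N_pos simp flip: of_nat_mult)
      also have "\<dots> = ln (real (N n)) + ln (real (N k))"
        using N_pos[of n] N_pos[of k] by (simp add: ln_mult)
      finally show ?thesis .
    qed
  qed
  then obtain L where L: "(\<lambda>n. ln (real (N n)) / real n) \<longlonglongrightarrow> L" by (auto simp: convergent_def)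
  obtain C where C: "C > 0" "\<And>n. real (card (words A (Suc n))) \<le> C * r ^ n"
    using card_words_bounds by metis
  have "ln (real (N n)) / real n \<le> (ln C + (real n + real p - 1) * ln r) / real n" for n
  proof -
    obtain q where q: "p = Suc q" using p(1) gr0_implies_Suc by blast
    have "real (N n) \<le> C * r ^ (n + q)"
      using N_le[of n] C(2)[of "n + q"] q by (simp add: order_trans[OF of_nat_mono])
    then have "ln (real (N n)) \<le> ln (C * r ^ (n + q))"
      using N_pos[of n] C(1) r_pos by simp
    also have "\<dots> = ln C + (real n + real p - 1) * ln r"
      using C(1) r_pos q by (simp add: ln_mult ln_realpow)
    finally show ?thesis by (simp add: divide_right_mono)
  qed
  moreover have "(\<lambda>n. (ln C + (real n + real p - 1) * ln r) / real n) \<longlonglongrightarrow> ln r"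
    by real_asymp
  ultimately have le: "L \<le> ln r" by (intro LIMSEQ_le[OF L]) auto
  have L': "(\<lambda>n. 1 / real n * ln (real (N n))) \<longlonglongrightarrow> L" using L by simp
  then have "cover_entropy X shift \<U> = ereal L"
    unfolding cover_entropy_def N_def by (intro limI tendsto_ereal)
  then show thesis using that le L' unfolding N_def by blast
qed

theorem topological_entropy_eq: "topological_entropy X shift = ereal (ln r)"
proof (rule antisym)
  show "topological_entropy X shift \<le> ereal (ln r)"
    unfolding topological_entropy_def
  proof (rule SUP_least)
    fix \<U> assume "\<U> \<in> {\<U>. open_cover X \<U>}"
    then obtain L where "cover_entropy X shift \<U> = ereal L" "L \<le> ln r"
      using cover_entropy_sandwich by blast
    then show "cover_entropy X shift \<U> \<le> ereal (ln r)" by simp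
  qed
  \<comment> \<open>The partition by first symbols attains the bound, since a subcover of its join
    is at least as large as the set of words.\<close>
  let ?U = "range (\<lambda>j. {x \<in> X. x 0 = j})"
  have cover: "open_cover X ?U"
    unfolding open_cover_def
  proof
    show "\<forall>U\<in>?U. openin (top_of_set X) U"
    proof
      fix U assume "U \<in> ?U"
      then have "determined_at A 1 U" by (auto simp: determined_at_def initial_word_eq_iff)
      then show "openin (top_of_set X) U" by (rule openin_determined_at)
    qed
  qed auto
  obtain L where L: "cover_entropy X shift ?U = ereal L" "L \<le> ln r"
    "(\<lambda>n. 1 / real n * ln (real (min_subcover_card X (iterated_join X shift ?U n)))) \<longlonglongrightarrow> L"
    by (rule cover_entropy_sandwich[OF cover])
  obtain p where p: "\<forall>x\<in>X. \<exists>V\<in>?U. cylinder A (initial_word p x) \<subseteq> V"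
    using open_cover_level[OF cover] by (elim exE conjE)
  have sub: "\<exists>\<V>\<subseteq>iterated_join X shift ?U n. finite \<V> \<and> \<Union>\<V> = X \<and> card \<V> \<le> card (words A (n + p))" for n
    by (rule iterated_join_subcover_words) (rule bspec[OF p])
  have fin: "\<exists>\<V>\<subseteq>iterated_join X shift ?U n. finite \<V> \<and> \<Union>\<V> = X" for n
    using sub[of n] by (elim exE conjE) (intro exI conjI)
  have "(real n - 1) / real n * ln r \<le> 1 / real n * ln (real (min_subcover_card X (iterated_join X shift ?U n)))"
    if "n \<ge> 1" for n
  proof -
    obtain k where k: "n = Suc k" using \<open>n \<ge> 1\<close> by (cases n) auto
    have "r ^ k \<le> real (card (words A n))" using card_words_bounds k by metis
    also have "\<dots> \<le> real (min_subcover_card X (iterated_join X shift ?U n))"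
      using card_words_le_min_subcover_card[OF fin] by simp
    finally have "ln (r ^ k) \<le> ln (real (min_subcover_card X (iterated_join X shift ?U n)))"
      using r_pos by (intro ln_mono) auto
    then have "(real n - 1) * ln r \<le> ln (real (min_subcover_card X (iterated_join X shift ?U n)))"
      using r_pos k by (simp add: ln_realpow)
    from divide_right_mono[OF this, of "real n"] show ?thesis by simp
  qed
  moreover have "(\<lambda>n. (real n - 1) / real n * ln r) \<longlonglongrightarrow> ln r" by real_asymp
  ultimately have "ln r \<le> L" by (intro LIMSEQ_le[OF _ L(3)]) auto
  then show "ereal (ln r) \<le> topological_entropy X shift"
    unfolding topological_entropy_def by (intro SUP_upper2[of ?U]) (auto simp: cover L(1))
qed

end

section \<open>Pulling back a conformal measure along an orbit equivalence\<close>

lemma continuous_shift: "continuous_on S shift"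
  unfolding shift_def
  by (intro continuous_on_coordinatewise_then_product
      continuous_on_subset[OF continuous_on_product_coordinates]) simp

text \<open>A homeomorphism need not respect cylinder lengths, but it preserves clopen sets, and
  these are the cylindrical ones.\<close>

lemma homeomorphism_cylindrical_image:
  assumes hom: "homeomorphism (markov_space A) (markov_space B) h g" and E: "cylindrical A E"
  shows "cylindrical B (h ` E)"
proof (rule clopen_imp_cylindrical)
  show "openin (top_of_set (markov_space B)) (h ` E)"
    using homeomorphism_imp_open_map[OF hom] cylindrical_imp_clopen(1)[OF E] by blast
  show "closedin (top_of_set (markov_space B)) (h ` E)"
    using homeomorphism_imp_closed_map[OF hom] cylindrical_imp_clopen(2)[OF E] by blast
qed

lemma cocycle_sum_Suc_shift:
  "cocycle_sum c (Suc n) x = c x + cocycle_sum c n (shift x)"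
  unfolding cocycle_sum_def
  by (subst sum.lessThan_Suc_shift) (simp add: funpow_Suc_right del: funpow.simps)

text \<open>One half of an orbit equivalence; the other half is an instance with \<open>A\<close>
  and \<open>B\<close> exchanged and the inverse homeomorphism.\<close>

locale orbit_map = PA: conformal_measure A \<mu> a + PB: conformal_measure B \<nu> b
  for A \<mu> a B \<nu> b +
  fixes h g :: "(nat \<Rightarrow> nat) \<Rightarrow> nat \<Rightarrow> nat" and k l :: "(nat \<Rightarrow> nat) \<Rightarrow> nat"
  assumes hom: "homeomorphism (markov_space A) (markov_space B) h g"
    and cont_k: "continuous_on (markov_space A) k"
    and cont_l: "continuous_on (markov_space A) l"
    and orbit: "x \<in> markov_space A \<Longrightarrow> (shift ^^ k x) (h (shift x)) = (shift ^^ l x) (h x)"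
begin

text \<open>On an adapted set \<open>shift ^^ p\<close> and \<open>shift ^^ q\<close> scale \<open>\<nu>\<close> by \<open>b ^ p\<close> and \<open>b ^ q\<close>, which turns the
  orbit equation into the scaling rule of \<open>pullback_shift\<close>.\<close>

definition adapted :: "(nat \<Rightarrow> nat) set \<Rightarrow> bool" where
  "adapted E \<longleftrightarrow> (\<exists>p q i u v. \<forall>y\<in>E. k y = p \<and> l y = q \<and> y 0 = i \<and>
     h (shift y) \<in> cylinder B (initial_word p u) \<and> h y \<in> cylinder B (initial_word q v))"

lemma adapted_mono: "V \<subseteq> U \<Longrightarrow> adapted U \<Longrightarrow> adapted V"
  unfolding adapted_def by (meson subsetD)

text \<open>Every datum in \<open>adapted\<close> is locally constant: continuous functions into
  \<open>nat\<close> have open fibres, and cylinders have open preimages under \<open>h\<close> and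
  under \<open>h\<close> after \<open>shift\<close>. The intersection is an open set around
  \<open>x\<close>.\<close>

lemma locally_adapted:
  assumes x: "x \<in> markov_space A"
  shows "\<exists>n. adapted (cylinder A (initial_word n x))"
proof -
  let ?X = "markov_space A" and ?Y = "markov_space B"
  have cont_h: "continuous_on ?X h" and hX: "h ` ?X = ?Y"
    using hom by (auto simp: homeomorphism_def)
  have sX: "shift ` ?X \<subseteq> ?X" by (auto intro: shift_in_markov_space)
  have cont_hs: "continuous_on ?X (\<lambda>y. h (shift y))"
    by (rule continuous_on_compose2[OF cont_h continuous_shift sX])
  have cont_0: "continuous_on ?X (\<lambda>y. y 0)"
    by (rule continuous_on_subset[OF continuous_on_product_coordinates]) simp
  have pre: "openin (top_of_set ?X) (?X \<inter> f -` {f x})" if "continuous_on ?X f" for f :: "_ \<Rightarrow> nat"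
    using that by (intro continuous_openin_preimage_gen) (auto simp: open_discrete)
  let ?C = "cylinder B (initial_word (k x) (h (shift x)))"
  let ?D = "cylinder B (initial_word (l x) (h x))"
  let ?U = "(?X \<inter> k -` {k x}) \<inter> (?X \<inter> l -` {l x}) \<inter> (?X \<inter> (\<lambda>y. y 0) -` {x 0}) \<inter>
    (?X \<inter> (\<lambda>y. h (shift y)) -` ?C) \<inter> (?X \<inter> h -` ?D)"
  have "openin (top_of_set ?X) (?X \<inter> (\<lambda>y. h (shift y)) -` ?C)"
    by (rule continuous_openin_preimage[OF cont_hs _ openin_cylinder]) (use sX hX in blast)
  moreover note pre[OF cont_k] pre[OF cont_l] pre[OF cont_0]
  moreover have "openin (top_of_set ?X) (?X \<inter> h -` ?D)"
    by (rule continuous_openin_preimage[OF cont_h _ openin_cylinder]) (use hX in blast)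
  ultimately have "openin (top_of_set ?X) ?U"
    by (simp only: openin_Int)
  moreover have "x \<in> ?U"
    using x hX shift_in_markov_space[OF x] by (auto simp: cylinder_initial_word)
  ultimately obtain n where "cylinder A (initial_word n x) \<subseteq> ?U"
    using openin_contains_cylinder by blast
  moreover have "adapted ?U"
    unfolding adapted_def
    by (rule exI[of _ "k x"], rule exI[of _ "l x"], rule exI[of _ "x 0"],
        rule exI[of _ "h (shift x)"], rule exI[of _ "h x"]) auto
  ultimately show ?thesis using adapted_mono by blast
qed

lemma pullback_shift:
  assumes E: "adapted E" "cylindrical A E" and x: "x \<in> E"
  shows "\<nu> (h ` shift ` E) = b powr real_of_int (cocycle k l x) * \<nu> (h ` E)"
proof -
  from E(1) obtain p q i u v where *: "\<And>y. y \<in> E \<Longrightarrow> k y = p \<and> l y = q \<and> y 0 = i \<and>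
     h (shift y) \<in> cylinder B (initial_word p u) \<and> h y \<in> cylinder B (initial_word q v)"
    unfolding adapted_def by blast
  have EX: "E \<subseteq> markov_space A" using E(2) by (auto simp: cylindrical_def determined_at_def)
  have "E \<subseteq> {x. x 0 = i}" using * by blast
  then have sE: "cylindrical A (shift ` E)" using PA.m_shift[OF E(2)] by blast
  have "b ^ p * \<nu> (h ` shift ` E) = \<nu> ((shift ^^ p) ` h ` shift ` E)"
    by (rule PB.m_funpow_shift[symmetric, of _ _ u])
      (use homeomorphism_cylindrical_image[OF hom sE] * in auto)
  \<comment> \<open>On \<open>E\<close> the exponents are the constants \<open>p\<close> and
    \<open>q\<close>, so the pointwise orbit equation becomes an equality of images.\<close>
  also have "(shift ^^ p) ` h ` shift ` E = (shift ^^ q) ` h ` E"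
    unfolding image_image using * orbit EX by (intro image_cong) force+
  also have "\<nu> \<dots> = b ^ q * \<nu> (h ` E)"
    by (rule PB.m_funpow_shift[of _ _ v])
      (use homeomorphism_cylindrical_image[OF hom E(2)] * in auto)
  finally have eq: "b ^ p * \<nu> (h ` shift ` E) = b ^ q * \<nu> (h ` E)" .
  have "cocycle k l x = int q - int p" using *[OF x] by (simp add: cocycle_def)
  then have "b powr real_of_int (cocycle k l x) = b ^ q / b ^ p"
    using PB.r_pos by (simp add: powr_diff powr_realpow)
  then have "b powr real_of_int (cocycle k l x) * \<nu> (h ` E) = b ^ q * \<nu> (h ` E) / b ^ p" by simp
  also have "\<dots> = \<nu> (h ` shift ` E)" using PB.r_pos by (simp flip: eq)
  finally show ?thesis ..
qed

text \<open>A length from which on all cylinders are adapted, fixed by \<open>SOME\<close> so that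
  later statements can share it; \<open>uniform_level\<close> provides one. Positivity is imposed
  because the image rule for shifted cylinders requires positive length.\<close>

definition level :: nat where
  "level = (SOME m. m > 0 \<and> (\<forall>x\<in>markov_space A. \<forall>n\<ge>m. adapted (cylinder A (initial_word n x))))"

lemma level: "level > 0" "x \<in> markov_space A \<Longrightarrow> level \<le> n \<Longrightarrow> adapted (cylinder A (initial_word n x))"
proof -
  obtain m where "\<And>x n. x \<in> markov_space A \<Longrightarrow> m \<le> n \<Longrightarrow> adapted (cylinder A (initial_word n x))"
    by (rule uniform_level[of A adapted]) (use locally_adapted adapted_mono in blast)+
  then have "\<exists>m>0. \<forall>x\<in>markov_space A. \<forall>n\<ge>m. adapted (cylinder A (initial_word n x))"
    by (intro exI[of _ "Suc m"]) auto
  from someI_ex[OF this] show "level > 0"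
    "x \<in> markov_space A \<Longrightarrow> level \<le> n \<Longrightarrow> adapted (cylinder A (initial_word n x))"
    unfolding level_def by blast+
qed

lemma pullback_cylinder_shift:
  assumes x: "x \<in> markov_space A" and n: "level \<le> n"
  shows "\<nu> (h ` cylinder A (initial_word n (shift x))) =
    b powr real_of_int (cocycle k l x) * \<nu> (h ` cylinder A (initial_word (Suc n) x))"
proof -
  have "\<nu> (h ` shift ` cylinder A (initial_word (Suc n) x)) =
    b powr real_of_int (cocycle k l x) * \<nu> (h ` cylinder A (initial_word (Suc n) x))"
  proof (rule pullback_shift)
    show "adapted (cylinder A (initial_word (Suc n) x))" using x n by (intro level(2)) simp_all
    show "cylindrical A (cylinder A (initial_word (Suc n) x))"
      unfolding cylindrical_def using determined_at_cylinder by blast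
  qed (use x in \<open>simp add: cylinder_initial_word\<close>)
  then show ?thesis using shift_image_cylinder[OF x, of n] level(1) n by simp
qed

text \<open>The factors collected along the orbit multiply to a power of \<open>b\<close> whose
  exponent is the cocycle sum. Stopping at length \<open>level\<close> leaves finitely many possible
  cylinders on the left.\<close>

lemma pullback_cylinder_funpow_shift:
  assumes "x \<in> markov_space A"
  shows "\<nu> (h ` cylinder A (initial_word level ((shift ^^ n) x))) =
    b powr real_of_int (cocycle_sum (cocycle k l) n x) * \<nu> (h ` cylinder A (initial_word (n + level) x))"
  using assms
proof (induction n arbitrary: x)
  case 0
  then show ?case using PB.r_pos by (simp add: cocycle_sum_def)
next
  case (Suc n)
  let ?c = "cocycle k l"
  have "\<nu> (h ` cylinder A (initial_word level ((shift ^^ n) (shift x)))) =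
     b powr real_of_int (cocycle_sum ?c n (shift x)) * \<nu> (h ` cylinder A (initial_word (n + level) (shift x)))"
    by (rule Suc.IH[OF shift_in_markov_space[OF Suc.prems]])
  also have "\<nu> (h ` cylinder A (initial_word (n + level) (shift x))) =
     b powr real_of_int (?c x) * \<nu> (h ` cylinder A (initial_word (Suc n + level) x))"
    using pullback_cylinder_shift[OF Suc.prems, of "n + level"] by simp
  finally show ?case
    by (simp add: cocycle_sum_Suc_shift powr_add funpow_Suc_right mult_ac del: funpow.simps)
qed

text \<open>The \<open>i\<close>-th summand depends on \<open>level\<close> symbols from place
  \<open>i\<close> on, because \<open>k\<close> and \<open>l\<close> are constant on adapted
  cylinders. The weight can thus be integrated as a finite sum over words.\<close>

lemma cocycle_sum_locally_constant:
  assumes "x \<in> markov_space A" "y \<in> markov_space A"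
    "initial_word (n + level) x = initial_word (n + level) y"
  shows "cocycle_sum (cocycle k l) n x = cocycle_sum (cocycle k l) n y"
  unfolding cocycle_sum_def
proof (rule sum.cong)
  fix i assume "i \<in> {..<n}"
  let ?x = "(shift ^^ i) x" and ?y = "(shift ^^ i) y"
  have xy: "?x \<in> markov_space A" "?y \<in> markov_space A"
    using assms by (auto intro: funpow_shift_in_markov_space)
  have "initial_word level ?y = initial_word level ?x"
    using assms(3) \<open>i \<in> {..<n}\<close> by (auto simp: initial_word_eq_iff funpow_shift)
  then have "?x \<in> cylinder A (initial_word level ?x)" "?y \<in> cylinder A (initial_word level ?x)"
    using xy by (auto simp: cylinder_initial_word)
  with level(2)[OF xy(1) order_refl] show "cocycle k l ?x = cocycle k l ?y"
    unfolding adapted_def cocycle_def by metis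
qed simp

lemma sum_pullback_cylinders: "(\<Sum>w\<in>words A n. \<nu> (h ` cylinder A w)) = 1"
proof -
  have inj: "inj_on h (markov_space A)" and hX: "h ` markov_space A = markov_space B"
    using hom by (auto simp: homeomorphism_def intro: inj_on_inverseI)
  have "\<nu> (\<Union>w\<in>words A n. h ` cylinder A w) = (\<Sum>w\<in>words A n. \<nu> (h ` cylinder A w))"
  proof (rule PB.m_UN[OF finite_words])
    show "cylindrical B (h ` cylinder A w)" if "w \<in> words A n" for w
      using homeomorphism_cylindrical_image[OF hom cylindrical_cylinder[OF that]] .
    show "disjoint_family_on (\<lambda>w. h ` cylinder A w) (words A n)"
      unfolding disjoint_family_on_def
    proof (intro ballI impI)
      fix v w assume "v \<in> words A n" "w \<in> words A n" "v \<noteq> w"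
      then have "cylinder A v \<inter> cylinder A w = {}"
        using disjoint_cylinders unfolding disjoint_family_on_def by blast
      then show "h ` cylinder A v \<inter> h ` cylinder A w = {}"
        using inj_on_image_Int[OF inj, of "cylinder A v" "cylinder A w"]
        by (auto simp: cylinder_def)
    qed
  qed
  moreover have "(\<Union>w\<in>words A n. cylinder A w) = markov_space A"
    by (auto simp: cylinder_word words_def cylinder_initial_word)
  then have "(\<Union>w\<in>words A n. h ` cylinder A w) = markov_space B"
    using hX by (metis image_UN)
  ultimately show ?thesis by (simp add: PB.m_space)
qed

text \<open>The cocycle factor converts \<open>\<mu>\<close>-mass into \<open>\<nu>\<close>-mass up
  to a ratio at a word of length \<open>level\<close>, so the scaled sum is a weighted mean of
  finitely many positive ratios. Their extremes serve as \<open>c\<close> and \<open>C\<close>,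
  independently of \<open>n\<close> and of the representatives \<open>z\<close>.\<close>

lemma weight_sum_bounds:
  "\<exists>c>0. \<exists>C. \<forall>n z. (\<forall>w\<in>words A (n + level). z w \<in> cylinder A w) \<longrightarrow>
    a ^ n * (\<Sum>w\<in>words A (n + level).
      b powr (- real_of_int (cocycle_sum (cocycle k l) n (z w))) * \<mu> (cylinder A w)) \<in> {c..C}"
proof -
  let ?\<rho> = "\<lambda>u. \<mu> (cylinder A u) / \<nu> (h ` cylinder A u)"
  let ?R = "?\<rho> ` words A level"
  have fin: "finite ?R" "?R \<noteq> {}"
    using finite_words PA.X_nonempty by (auto simp: words_def)
  have \<nu>_pos: "\<nu> (h ` cylinder A u) > 0" if "u \<in> words A n" for u n
  proof (rule PB.m_pos)
    show "cylindrical B (h ` cylinder A u)"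
      by (rule homeomorphism_cylindrical_image[OF hom cylindrical_cylinder[OF that]])
    show "h ` cylinder A u \<noteq> {}"
      using that by (auto simp: words_def cylinder_initial_word)
  qed
  have "?\<rho> u > 0" if "u \<in> words A level" for u
    using that PA.m_cylinder_pos \<nu>_pos[OF that] by (auto simp: words_def)
  then have c: "Min ?R > 0" using fin by auto
  have summand: "a ^ n * (b powr (- real_of_int (cocycle_sum (cocycle k l) n (z w))) * \<mu> (cylinder A w)) =
      \<nu> (h ` cylinder A w) * ?\<rho> (initial_word level ((shift ^^ n) (z w)))"
    and mem: "initial_word level ((shift ^^ n) (z w)) \<in> words A level"
    if w: "w \<in> words A (n + level)" and z: "z w \<in> cylinder A w" for n w z
  proof -
    let ?x = "z w" and ?s = "real_of_int (cocycle_sum (cocycle k l) n (z w))"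
    have x: "?x \<in> markov_space A" "w = initial_word (n + level) ?x"
      using w z by (auto simp: cylinder_word)
    show u: "initial_word level ((shift ^^ n) ?x) \<in> words A level" (is "?u \<in> _")
      using funpow_shift_in_markov_space[OF x(1)] by (auto simp: words_def)
    have \<mu>: "\<mu> (cylinder A ?u) = a ^ n * \<mu> (cylinder A w)"
      using PA.m_cylinder_funpow_shift[OF x(1) level(1), of n] x(2) by simp
    have \<nu>: "\<nu> (h ` cylinder A ?u) = b powr ?s * \<nu> (h ` cylinder A w)"
      using pullback_cylinder_funpow_shift[OF x(1), of n] x(2) by simp
    have "b powr ?s > 0" using PB.r_pos by simp
    then show "a ^ n * (b powr (- ?s) * \<mu> (cylinder A w)) = \<nu> (h ` cylinder A w) * ?\<rho> ?u"
      unfolding \<mu> \<nu> using \<nu>_pos[OF w] by (simp add: powr_minus field_simps)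
  qed
  have total: "a ^ n * (\<Sum>w\<in>words A (n + level).
        b powr (- real_of_int (cocycle_sum (cocycle k l) n (z w))) * \<mu> (cylinder A w)) =
      (\<Sum>w\<in>words A (n + level). \<nu> (h ` cylinder A w) * ?\<rho> (initial_word level ((shift ^^ n) (z w))))"
    if "\<And>w. w \<in> words A (n + level) \<Longrightarrow> z w \<in> cylinder A w" for n z
    unfolding sum_distrib_left by (rule sum.cong[OF refl], rule summand) (use that in auto)
  have "a ^ n * (\<Sum>w\<in>words A (n + level).
      b powr (- real_of_int (cocycle_sum (cocycle k l) n (z w))) * \<mu> (cylinder A w)) \<in> {Min ?R..Max ?R}"
    if z: "\<forall>w\<in>words A (n + level). z w \<in> cylinder A w" for n z
  proof -
    let ?T = "\<Sum>w\<in>words A (n + level). \<nu> (h ` cylinder A w) * ?\<rho> (initial_word level ((shift ^^ n) (z w)))"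
    have "(\<Sum>w\<in>words A (n + level). \<nu> (h ` cylinder A w) * Min ?R) \<le> ?T"
      using mem z fin by (intro sum_mono mult_left_mono less_imp_le[OF \<nu>_pos]) (auto intro!: Min_le)
    moreover have "?T \<le> (\<Sum>w\<in>words A (n + level). \<nu> (h ` cylinder A w) * Max ?R)"
      using mem z fin by (intro sum_mono mult_left_mono less_imp_le[OF \<nu>_pos]) (auto intro!: Max_ge)
    \<comment> \<open>The weights have sum one, so bounds on the ratios pass to the mean.\<close>
    moreover have "(\<Sum>w\<in>words A (n + level). \<nu> (h ` cylinder A w) * x) = x" for x
      by (simp add: sum_distrib_right[symmetric] sum_pullback_cylinders)
    ultimately show ?thesis
      by (subst total) (use z in auto)
  qed
  with c show ?thesis by blast
qed

text \<open>The product \<open>a ^ n * S n\<close> stays between positive constants, so its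
  logarithm vanishes after division by \<open>n\<close>.\<close>

lemma weight_growth_rate:
  assumes S: "\<And>n. S n = (\<Sum>w\<in>words A (n + level).
    b powr (- real_of_int (cocycle_sum (cocycle k l) n (z n w))) * \<mu> (cylinder A w))"
    and z: "\<And>n w. w \<in> words A (n + level) \<Longrightarrow> z n w \<in> cylinder A w"
  shows "(\<lambda>n. 1 / real n * ln (S n)) \<longlonglongrightarrow> - ln a"
proof -
  obtain c C where c: "c > 0" and bounds: "\<forall>n z. (\<forall>w\<in>words A (n + level). z w \<in> cylinder A w) \<longrightarrow>
    a ^ n * (\<Sum>w\<in>words A (n + level).
      b powr (- real_of_int (cocycle_sum (cocycle k l) n (z w))) * \<mu> (cylinder A w)) \<in> {c..C}"
    using weight_sum_bounds by (elim exE conjE)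
  have le: "c \<le> a ^ n * S n" and ge: "a ^ n * S n \<le> C" for n
    using bounds[rule_format, of n "z n"] z by (auto simp: S)
  have pos: "0 < a ^ n * S n" for n using c le[of n] by linarith
  then have S_pos: "0 < S n" for n
    using PA.r_pos by (metis zero_less_mult_pos zero_less_power)
  have eq: "1 / real n * ln (S n) = ln (a ^ n * S n) / real n - ln a" if "n > 0" for n
    using that PA.r_pos S_pos[of n] by (simp add: ln_mult ln_realpow field_simps)
  have "(\<lambda>n. ln (a ^ n * S n) / real n) \<longlonglongrightarrow> 0"
  proof (rule tendsto_sandwich)
    show "\<forall>\<^sub>F n in sequentially. ln c / real n \<le> ln (a ^ n * S n) / real n"
      using c le by (intro always_eventually allI divide_right_mono ln_mono) auto
    show "\<forall>\<^sub>F n in sequentially. ln (a ^ n * S n) / real n \<le> ln C / real n"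
      using pos ge by (intro always_eventually allI divide_right_mono ln_mono) auto
  qed real_asymp+
  then have "(\<lambda>n. ln (a ^ n * S n) / real n - ln a) \<longlonglongrightarrow> 0 - ln a" by (intro tendsto_diff tendsto_const)
  moreover have "\<forall>\<^sub>F n in sequentially. 1 / real n * ln (S n) = ln (a ^ n * S n) / real n - ln a"
    using eq eventually_gt_at_top[of 0] by (rule eventually_mono[rotated])
  ultimately show ?thesis by (simp add: tendsto_cong)
qed

end

section \<open>KMS states of the gauge action\<close>

context cstar_algebra
begin

lemma cscale_zero_left: assumes "x \<in> carrier R" shows "cscale R 0 x = \<zero>"
proof -
  have "cscale R 0 x \<oplus> cscale R 0 x = cscale R 0 x"
    using cscale_add_left[OF assms, of 0 0] by simp
  then show ?thesis using add.r_cancel_one[of "cscale R 0 x" "cscale R 0 x"] cscale_closed[OF assms] by simp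
qed

lemma cscale_minus_left: assumes "x \<in> carrier R" shows "cscale R c x \<ominus> cscale R d x = cscale R (c - d) x"
proof -
  have "cscale R (- d) x \<oplus> cscale R d x = \<zero>"
    using cscale_add_left[OF assms, of "- d" d] cscale_zero_left[OF assms] by simp
  then have "\<ominus> cscale R d x = cscale R (- d) x"
    by (intro minus_equality cscale_closed assms)
  then show ?thesis using cscale_add_left[OF assms, of c "- d"] by (simp add: a_minus_def)
qed

text \<open>The scalar factor extends to an entire function. All difference quotients are multiples
  of \<open>s\<close>, so convergence in norm reduces to complex differentiability of that
  function.\<close>

lemma entire_extension_eigenvector:
  assumes s: "s \<in> carrier R"
    and eigen: "\<And>t. \<alpha> t s = cscale R (exp (\<i> * complex_of_real t)) s"
  shows "entire_extension R \<alpha> s (\<lambda>z. cscale R (exp (\<i> * z)) s)"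
  unfolding entire_extension_def
proof (intro conjI allI)
  fix z :: complex
  let ?f = "\<lambda>z. exp (\<i> * z)"
  have "(?f has_field_derivative \<i> * ?f z) (at z)"
    by (auto intro!: derivative_eq_intros)
  then have "((\<lambda>w. (?f w - ?f z) / (w - z)) \<longlongrightarrow> \<i> * ?f z) (at z)"
    by (simp add: has_field_derivative_iff)
  then have "((\<lambda>w. cmod ((?f w - ?f z) / (w - z) - \<i> * ?f z) * cnorm R s) \<longlongrightarrow> 0 * cnorm R s) (at z)"
    by (intro tendsto_mult tendsto_const tendsto_norm_zero) (simp add: LIM_zero)
  moreover have "cdist R (cscale R (1 / (w - z)) (cscale R (?f w) s \<ominus> cscale R (?f z) s)) (cscale R (\<i> * ?f z) s) =
      cmod ((?f w - ?f z) / (w - z) - \<i> * ?f z) * cnorm R s" for w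
    using s by (simp add: cdist_def cscale_closed cscale_minus_left cscale_cscale cnorm_cscale)
  ultimately show "\<exists>D\<in>carrier R. ((\<lambda>w. cdist R (cscale R (1 / (w - z))
      (cscale R (exp (\<i> * w)) s \<ominus> cscale R (exp (\<i> * z)) s)) D) \<longlongrightarrow> 0) (at z)"
    using s by (intro bexI[of _ "cscale R (\<i> * ?f z) s"]) (simp_all add: cscale_closed)
qed (use s eigen in \<open>auto intro: cscale_closed\<close>)

text \<open>At the point \<open>\<i> * ln \<beta>\<close> the entire extension multiplies
  \<open>s\<close> by \<open>1 / \<beta>\<close>, so the KMS condition becomes a twisted trace
  property.\<close>

lemma kms_state_eigenvector:
  assumes kms: "kms_state R \<alpha> \<beta> \<psi>" and s: "s \<in> carrier R" and y: "y \<in> carrier R"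
    and eigen: "\<And>t. \<alpha> t s = cscale R (exp (\<i> * complex_of_real t)) s"
  shows "\<psi> (y \<otimes> s) = \<beta> * \<psi> (s \<otimes> y)"
proof -
  have \<beta>: "\<beta> > 0" and lin: "\<psi> (cscale R c x) = c * \<psi> x" if "x \<in> carrier R" for c x
    using kms that by (auto simp: kms_state_def state_def)
  have "\<psi> (y \<otimes> cscale R (exp (\<i> * (\<i> * complex_of_real (ln \<beta>)))) s) = \<psi> (s \<otimes> y)"
    using kms entire_extension_eigenvector[where \<alpha> = \<alpha>, OF s eigen] s y
    unfolding kms_state_def by blast
  moreover have "\<i> * (\<i> * complex_of_real (ln \<beta>)) = complex_of_real (- ln \<beta>)"
    by (simp add: algebra_simps flip: mult.assoc)
  then have "exp (\<i> * (\<i> * complex_of_real (ln \<beta>))) = complex_of_real (1 / \<beta>)"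
    using \<beta>[OF s] by (simp only: exp_of_real) (simp add: exp_minus divide_inverse)
  ultimately have "complex_of_real (1 / \<beta>) * \<psi> (y \<otimes> s) = \<psi> (s \<otimes> y)"
    using s y by (simp add: cscale_mult_right lin)
  then show ?thesis using \<beta>[OF s] by (auto simp: field_simps)
qed

end

section \<open>The diagonal as functions on the shift space\<close>

lemma continuous_on_determined:
  fixes f :: "(nat \<Rightarrow> nat) \<Rightarrow> 'b::topological_space"
  assumes "\<And>x y. \<lbrakk>x \<in> markov_space A; y \<in> markov_space A; initial_word n x = initial_word n y\<rbrakk> \<Longrightarrow> f x = f y"
  shows "continuous_on (markov_space A) f"
  unfolding continuous_openin_preimage_eq
proof (intro allI impI)
  fix T :: "'b set"
  have "determined_at A n (markov_space A \<inter> f -` T)"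
    unfolding determined_at_def using assms by (metis IntD1 IntD2 IntI inf_le1 vimageD vimageI)
  then show "openin (top_of_set (markov_space A)) (markov_space A \<inter> f -` T)"
    by (rule openin_determined_at)
qed

lemma word_prod_Cons: "word_prod R S (i # w) = S i \<otimes>\<^bsub>R\<^esub> word_prod R S w"
  by (simp add: word_prod_def)

locale gauge_kms = markov_shift A + cstar_algebra R for A and R :: "'a cstar" (structure) +
  fixes S :: "nat \<Rightarrow> 'a" and \<gamma> :: "real \<Rightarrow> 'a \<Rightarrow> 'a"
    and \<iota> :: "((nat \<Rightarrow> nat) \<Rightarrow> complex) \<Rightarrow> 'a" and \<beta> :: real and \<phi> :: "'a \<Rightarrow> complex"
  assumes family: "cuntz_krieger_family A R S"
    and diagonal: "diagonal_identification A R S \<iota>"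
    and gauge: "gauge_action A R S \<gamma>"
    and kms: "kms_state R \<gamma> \<beta> \<phi>"
begin

text \<open>Restricted to the space because the carrier of \<open>CX\<close> consists of extensional
  functions.\<close>

definition ind :: "(nat \<Rightarrow> nat) set \<Rightarrow> (nat \<Rightarrow> nat) \<Rightarrow> complex" where
  "ind E = (\<lambda>x\<in>markov_space A. indicator E x)"

text \<open>On cylindrical sets the complex value is a nonnegative real, so \<open>Re\<close> loses
  nothing there.\<close>

definition meas :: "(nat \<Rightarrow> nat) set \<Rightarrow> real" where
  "meas E = Re (\<phi> (\<iota> (ind E)))"

abbreviation "CX \<equiv> cfun_algebra (markov_space A)"

lemma S_closed: "i < dim_row A \<Longrightarrow> S i \<in> carrier R"
  using family by (auto simp: cuntz_krieger_family_def partial_isometry_def)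

lemma \<beta>_pos: "\<beta> > 0"
  using kms by (simp add: kms_state_def)

lemma \<phi>_add: "x \<in> carrier R \<Longrightarrow> y \<in> carrier R \<Longrightarrow> \<phi> (x \<oplus> y) = \<phi> x + \<phi> y"
  and \<phi>_cscale: "x \<in> carrier R \<Longrightarrow> \<phi> (cscale R c x) = c * \<phi> x"
  and \<phi>_positive: "x \<in> carrier R \<Longrightarrow> \<phi> (star R x \<otimes> x) \<in> \<real>\<^sub>\<ge>\<^sub>0"
  and \<phi>_one: "\<phi> \<one> = 1"
  using kms by (auto simp: kms_state_def state_def)

lemma \<iota>_hom: "\<iota> \<in> ring_hom CX R"
  and \<iota>_cscale: "f \<in> carrier CX \<Longrightarrow> \<iota> (cscale CX c f) = cscale R c (\<iota> f)"
  and \<iota>_star: "f \<in> carrier CX \<Longrightarrow> \<iota> (star CX f) = star R (\<iota> f)"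
  using diagonal unfolding diagonal_identification_def star_hom_def by blast+

lemmas \<iota>_closed = ring_hom_closed[OF \<iota>_hom]
  and \<iota>_add = ring_hom_add[OF \<iota>_hom]
  and \<iota>_mult = ring_hom_mult[OF \<iota>_hom]
  and \<iota>_one = ring_hom_one[OF \<iota>_hom]

lemma determined_in_CX:
  assumes "\<And>x y. \<lbrakk>x \<in> markov_space A; y \<in> markov_space A; initial_word n x = initial_word n y\<rbrakk> \<Longrightarrow> f x = f y"
  shows "(\<lambda>x\<in>markov_space A. f x) \<in> carrier CX"
proof -
  have "continuous_on (markov_space A) (\<lambda>x\<in>markov_space A. f x)"
  proof (rule continuous_on_determined[of A n])
    fix x y assume xy: "x \<in> markov_space A" "y \<in> markov_space A" "initial_word n x = initial_word n y"
    then have "f x = f y" by (rule assms)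
    with xy(1,2) show "(\<lambda>x\<in>markov_space A. f x) x = (\<lambda>x\<in>markov_space A. f x) y" by simp
  qed
  then show ?thesis by (simp add: cfun_algebra_def)
qed

lemma ind_closed:
  assumes "cylindrical A E" shows "ind E \<in> carrier CX"
proof -
  obtain n where "determined_at A n E" using assms by (auto simp: cylindrical_def)
  then show ?thesis unfolding ind_def
    by (intro determined_in_CX[of n]) (auto simp: determined_at_def indicator_def)
qed

lemma mult_CX: "f \<otimes>\<^bsub>CX\<^esub> g = (\<lambda>x\<in>markov_space A. f x * g x)"
  and add_CX: "f \<oplus>\<^bsub>CX\<^esub> g = (\<lambda>x\<in>markov_space A. f x + g x)"
  and one_CX: "\<one>\<^bsub>CX\<^esub> = (\<lambda>x\<in>markov_space A. 1)"
  and cscale_CX: "cscale CX c f = (\<lambda>x\<in>markov_space A. c * f x)"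
  and star_CX: "star CX f = (\<lambda>x\<in>markov_space A. cnj (f x))"
  by (simp_all add: cfun_algebra_def)

lemma \<iota>_ind_mult:
  assumes "cylindrical A E" "cylindrical A F"
  shows "\<iota> (ind E) \<otimes> \<iota> (ind F) = \<iota> (ind (E \<inter> F))"
proof -
  have "ind (E \<inter> F) = ind E \<otimes>\<^bsub>CX\<^esub> ind F"
    by (auto simp: mult_CX ind_def indicator_def)
  then show ?thesis using \<iota>_mult ind_closed assms by simp
qed

lemma \<iota>_ind_empty: "\<iota> (ind {}) = \<zero>"
proof -
  \<comment> \<open>Membership in \<open>ring_hom\<close> covers sums, products and the unit;
    preservation of zero is obtained from scaling by \<open>0\<close>.\<close>
  have "ind {} = cscale CX 0 (ind {})" by (simp add: cscale_CX ind_def)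
  then have "\<iota> (ind {}) = cscale R 0 (\<iota> (ind {}))"
    using \<iota>_cscale ind_closed cylindrical_empty by metis
  then show ?thesis using cscale_zero_left[OF \<iota>_closed[OF ind_closed[OF cylindrical_empty]]] by simp
qed

lemma admissible_word:
  assumes "w \<in> words A n" "n > 0" shows "admissible A w"
proof -
  from assms(1) obtain x where "x \<in> X" "w = initial_word n x" by (auto simp: words_def)
  moreover have "length w = n" using assms(1) by (auto simp: words_def)
  then have "w \<noteq> []" using assms(2) by auto
  ultimately show ?thesis unfolding admissible_def by (auto intro!: bexI[of _ x] exI[of _ 0])
qed

lemma \<iota>_ind_cylinder:
  assumes "w \<in> words A n" "n > 0" shows "\<iota> (ind (cylinder A w)) = word_proj R S w"
  using diagonal admissible_word[OF assms] unfolding diagonal_identification_def ind_def by blast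

lemma word_prod_closed: "set w \<subseteq> {..<dim_row A} \<Longrightarrow> word_prod R S w \<in> carrier R"
  by (induction w) (auto simp: word_prod_Cons S_closed, simp add: word_prod_def)

lemma word_proj_Cons:
  assumes "i < dim_row A" "set w \<subseteq> {..<dim_row A}"
  shows "word_proj R S (i # w) = S i \<otimes> (word_proj R S w \<otimes> star R (S i))"
  using S_closed[OF assms(1)] word_prod_closed[OF assms(2)]
  by (simp add: word_proj_def word_prod_Cons star_mult star_closed m_assoc)

lemma set_words: "w \<in> words A n \<Longrightarrow> set w \<subseteq> {..<dim_row A}"
  by (auto simp: words_def initial_word_def markov_space_def)

lemma singleton_word: "i < dim_row A \<Longrightarrow> [i] \<in> words A 1"
  using point_above[of i] by (force simp: words_def initial_word_def)

text \<open>The initial projection of \<open>S (x 0)\<close> is the sum of the range projections of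
  the allowed successors. The projection of a word starting with \<open>x 1\<close> lies under the
  summand of \<open>x 1\<close>, whose coefficient is one, and is orthogonal to the others.\<close>

lemma initial_projection_absorbs:
  assumes x: "x \<in> X" and n: "n > 0"
  shows "word_proj R S (initial_word n (shift x)) \<otimes> (star R (S (x 0)) \<otimes> S (x 0)) =
    word_proj R S (initial_word n (shift x))"
proof -
  let ?N = "dim_row A" and ?w = "initial_word n (shift x)"
  have w: "?w \<in> words A n" using shift_in_markov_space[OF x] by (auto simp: words_def)
  have xN: "x 0 < ?N" "x 1 < ?N" "A $$ (x 0, x 1) = 1" using x by (auto simp: markov_space_def)
  let ?P = "\<iota> (ind (cylinder A ?w))"
  have P: "?P = word_proj R S ?w" by (rule \<iota>_ind_cylinder[OF w n])
  have cyl: "cylindrical A (cylinder A ?w)" by (rule cylindrical_cylinder[OF w])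
  have P_closed: "?P \<in> carrier R" by (rule \<iota>_closed[OF ind_closed[OF cyl]])
  \<comment> \<open>Writing range projections as images of indicators turns their products into
    intersections of cylinders.\<close>
  let ?Q = "\<lambda>j. \<iota> (ind (cylinder A [j]))"
  have Q_closed: "?Q j \<in> carrier R" if "j < ?N" for j
    by (rule \<iota>_closed[OF ind_closed[OF cylindrical_cylinder[OF singleton_word[OF that]]]])
  have Q: "S j \<otimes> star R (S j) = ?Q j" if "j < ?N" for j
    using \<iota>_ind_cylinder[OF singleton_word[OF that]] S_closed[OF that]
    by (simp add: word_proj_def word_prod_def)
  have PQ: "?P \<otimes> ?Q j = (if x 1 = j then ?P else \<zero>)" if j: "j < ?N" for j
  proof -
    have "?P \<otimes> ?Q j = \<iota> (ind (cylinder A ?w \<inter> cylinder A [j]))"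
      by (rule \<iota>_ind_mult[OF cyl cylindrical_cylinder[OF singleton_word[OF j]]])
    moreover have "y 0 = x 1" if "y \<in> cylinder A ?w" for y
      using that n by (auto simp: cylinder_def shift_def)
    then have "cylinder A ?w \<inter> cylinder A [j] = (if x 1 = j then cylinder A ?w else {})"
      by (auto simp: cylinder_def)
    ultimately show ?thesis by (simp add: \<iota>_ind_empty)
  qed
  have "star R (S (x 0)) \<otimes> S (x 0) = (\<Oplus>j\<in>{..<?N}. cscale R (of_nat (A $$ (x 0, j))) (S j \<otimes> star R (S j)))"
    using family xN(1) by (simp add: cuntz_krieger_family_def)
  also have "\<dots> = (\<Oplus>j\<in>{..<?N}. cscale R (of_nat (A $$ (x 0, j))) (?Q j))"
    using Q Q_closed cscale_closed by (intro finsum_cong') auto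
  finally have "?P \<otimes> (star R (S (x 0)) \<otimes> S (x 0)) =
      ?P \<otimes> (\<Oplus>j\<in>{..<?N}. cscale R (of_nat (A $$ (x 0, j))) (?Q j))" by simp
  also have "\<dots> = (\<Oplus>j\<in>{..<?N}. ?P \<otimes> cscale R (of_nat (A $$ (x 0, j))) (?Q j))"
    using P_closed Q_closed cscale_closed by (intro finsum_rdistr) auto
  also have "\<dots> = (\<Oplus>j\<in>{..<?N}. if x 1 = j then ?P else \<zero>)"
  proof (rule finsum_cong'[OF refl])
    fix j assume "j \<in> {..<?N}"
    then have "?P \<otimes> cscale R (of_nat (A $$ (x 0, j))) (?Q j) =
        cscale R (of_nat (A $$ (x 0, j))) (if x 1 = j then ?P else \<zero>)"
      using P_closed Q_closed PQ by (simp only: cscale_mult_right lessThan_iff)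
    moreover have "cscale R c \<zero> = \<zero>" for c
      using cscale_cscale[OF zero_closed, of c 0] cscale_zero_left[OF zero_closed] by simp
    ultimately show "?P \<otimes> cscale R (of_nat (A $$ (x 0, j))) (?Q j) = (if x 1 = j then ?P else \<zero>)"
      using xN P_closed by (auto simp: cscale_one)
  qed (use P_closed in auto)
  also have "\<dots> = ?P"
    using add.finprod_singleton[of "x 1" "{..<?N}" "\<lambda>_. ?P"] xN P_closed by (simp add: finsum_def)
  finally show ?thesis by (simp add: P)
qed

text \<open>Membership in the carrier is part of the same induction, because additivity of
  \<open>\<iota>\<close> requires it of the partial sums.\<close>

lemma \<phi>_\<iota>_sum:
  assumes "finite I" "\<And>i. i \<in> I \<Longrightarrow> cylindrical A (E i)"
  shows "(\<lambda>x\<in>markov_space A. \<Sum>i\<in>I. c i * ind (E i) x) \<in> carrier CX \<and>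
    \<phi> (\<iota> (\<lambda>x\<in>markov_space A. \<Sum>i\<in>I. c i * ind (E i) x)) = (\<Sum>i\<in>I. c i * \<phi> (\<iota> (ind (E i))))"
  using assms
proof (induction I rule: finite_induct)
  case empty
  have eq: "(\<lambda>x\<in>markov_space A. 0) = ind {}" by (auto simp: ind_def)
  have "\<phi> \<zero> = 0" using \<phi>_cscale[OF zero_closed, of 0] cscale_zero_left[OF zero_closed] by simp
  then show ?case using ind_closed[OF cylindrical_empty] by (simp add: eq \<iota>_ind_empty)
next
  case (insert i I)
  let ?f = "cscale CX (c i) (ind (E i))" and ?g = "\<lambda>x\<in>markov_space A. \<Sum>i\<in>I. c i * ind (E i) x"
  have E: "ind (E i) \<in> carrier CX" using insert.prems by (intro ind_closed) auto
  then have f: "?f \<in> carrier CX"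
    by (simp add: cfun_algebra_def continuous_on_mult_left)
  have g: "?g \<in> carrier CX" "\<phi> (\<iota> ?g) = (\<Sum>i\<in>I. c i * \<phi> (\<iota> (ind (E i))))"
    using insert.IH[OF insert.prems[OF insertI2]] by blast+
  have eq: "(\<lambda>x\<in>markov_space A. \<Sum>i\<in>insert i I. c i * ind (E i) x) = ?f \<oplus>\<^bsub>CX\<^esub> ?g"
    using insert.hyps by (auto simp: add_CX cscale_CX)
  have "?f \<oplus>\<^bsub>CX\<^esub> ?g \<in> carrier CX"
    using f g(1) by (auto simp: cfun_algebra_def intro!: continuous_on_add)
  moreover have "\<phi> (\<iota> (?f \<oplus>\<^bsub>CX\<^esub> ?g)) = c i * \<phi> (\<iota> (ind (E i))) + \<phi> (\<iota> ?g)"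
    using f g(1) E by (simp add: \<iota>_add \<phi>_add \<iota>_closed \<iota>_cscale \<phi>_cscale cscale_closed)
  ultimately show ?case unfolding eq using insert.hyps by (simp add: g(2))
qed

text \<open>A function of the first \<open>n\<close> symbols is a finite combination of cylinder
  indicators, with coefficients read off at arbitrary representatives \<open>z w\<close>.\<close>

lemma \<phi>_\<iota>_determined:
  assumes f: "\<And>x y. \<lbrakk>x \<in> markov_space A; y \<in> markov_space A; initial_word n x = initial_word n y\<rbrakk> \<Longrightarrow> f x = f y"
    and z: "\<And>w. w \<in> words A n \<Longrightarrow> z w \<in> cylinder A w"
  shows "Re (\<phi> (\<iota> (\<lambda>x\<in>markov_space A. complex_of_real (f x)))) = (\<Sum>w\<in>words A n. f (z w) * meas (cylinder A w))"
proof -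
  have "complex_of_real (f x) = (\<Sum>w\<in>words A n. complex_of_real (f (z w)) * ind (cylinder A w) x)"
    if x: "x \<in> markov_space A" for x
  proof -
    have wx: "initial_word n x \<in> words A n" using x by (auto simp: words_def)
    have "f (z (initial_word n x)) = f x"
      using z[OF wx] x by (intro f) (auto simp: cylinder_initial_word)
    then have "(\<Sum>w\<in>words A n. complex_of_real (f (z w)) * ind (cylinder A w) x) =
        (\<Sum>w\<in>words A n. if w = initial_word n x then complex_of_real (f x) else 0)"
      using x by (intro sum.cong) (auto simp: ind_def cylinder_word indicator_def)
    then show ?thesis using wx finite_words by (simp add: sum.delta')
  qed
  then have "(\<lambda>x\<in>markov_space A. complex_of_real (f x)) =
      (\<lambda>x\<in>markov_space A. \<Sum>w\<in>words A n. complex_of_real (f (z w)) * ind (cylinder A w) x)"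
    by (intro restrict_ext)
  then have "\<phi> (\<iota> (\<lambda>x\<in>markov_space A. complex_of_real (f x))) =
      (\<Sum>w\<in>words A n. complex_of_real (f (z w)) * \<phi> (\<iota> (ind (cylinder A w))))"
    using \<phi>_\<iota>_sum[OF finite_words[of A n], of "cylinder A"] cylindrical_cylinder by auto
  then show ?thesis by (simp add: meas_def)
qed

text \<open>The scaling rule is the twisted trace property for \<open>S (x 0)\<close>: moving it
  from one side of the word projection times \<open>star R (S (x 0))\<close> to the other gives the
  projection of the word of \<open>shift x\<close> in one order and that of the longer word of
  \<open>x\<close> in the other.\<close>

sublocale conformal_measure A meas \<beta>
proof
  show "\<beta> > 0" by (rule \<beta>_pos)
  fix E F assume E: "cylindrical A E"
  \<comment> \<open>An indicator is a self-adjoint idempotent, hence of the form on which a state is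
    nonnegative.\<close>
  have "ind E = star CX (ind E) \<otimes>\<^bsub>CX\<^esub> ind E"
    by (auto simp: star_CX mult_CX ind_def indicator_def)
  moreover have "star CX (ind E) = ind E"
    by (auto simp: star_CX ind_def indicator_def)
  ultimately have "\<iota> (ind E) = star R (\<iota> (ind E)) \<otimes> \<iota> (ind E)"
    using \<iota>_mult \<iota>_star ind_closed[OF E] by metis
  then have "\<phi> (\<iota> (ind E)) \<in> \<real>\<^sub>\<ge>\<^sub>0"
    using \<phi>_positive[OF \<iota>_closed[OF ind_closed[OF E]]] by simp
  then show "0 \<le> meas E" by (simp add: meas_def complex_nonneg_Reals_iff)
  assume F: "cylindrical A F" and disj: "E \<inter> F = {}"
  have "ind (E \<union> F) = ind E \<oplus>\<^bsub>CX\<^esub> ind F"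
    using disj by (intro ext) (auto simp: add_CX ind_def indicator_def)
  then show "meas (E \<union> F) = meas E + meas F"
    using E F by (simp add: meas_def \<iota>_add ind_closed \<phi>_add \<iota>_closed)
next
  have "ind (markov_space A) = \<one>\<^bsub>CX\<^esub>" by (auto simp: one_CX ind_def)
  then show "meas (markov_space A) = 1" by (simp add: meas_def \<iota>_one \<phi>_one)
next
  fix x n assume x: "x \<in> markov_space A" and n: "(n::nat) > 0"
  let ?w = "initial_word n (shift x)" and ?s = "S (x 0)"
  have w: "?w \<in> words A n" "initial_word (Suc n) x \<in> words A (Suc n)"
    using shift_in_markov_space[OF x] x by (auto simp: words_def)
  have x0: "x 0 < dim_row A" using x by (auto simp: markov_space_def)
  then have s: "?s \<in> carrier R" by (rule S_closed)
  have W: "word_proj R S ?w \<in> carrier R"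
    using word_prod_closed[OF set_words[OF w(1)]] by (simp add: word_proj_def star_closed)
  have "\<phi> ((word_proj R S ?w \<otimes> star R ?s) \<otimes> ?s) = \<beta> * \<phi> (?s \<otimes> (word_proj R S ?w \<otimes> star R ?s))"
    using gauge x0 s W by (intro kms_state_eigenvector[OF kms]) (auto simp: gauge_action_def star_closed)
  moreover have "(word_proj R S ?w \<otimes> star R ?s) \<otimes> ?s = word_proj R S ?w"
    using initial_projection_absorbs[OF x n] s W by (simp add: m_assoc star_closed)
  moreover have "?s \<otimes> (word_proj R S ?w \<otimes> star R ?s) = word_proj R S (initial_word (Suc n) x)"
    using word_proj_Cons[OF x0 set_words[OF w(1)]] by (simp add: initial_word_Suc)
  ultimately have "\<phi> (\<iota> (ind (cylinder A ?w))) = \<beta> * \<phi> (\<iota> (ind (cylinder A (initial_word (Suc n) x))))"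
    using \<iota>_ind_cylinder[OF w(1) n] \<iota>_ind_cylinder[OF w(2)] by simp
  then show "meas (cylinder A ?w) = \<beta> * meas (cylinder A (initial_word (Suc n) x))"
    by (simp add: meas_def)
qed

end

text \<open>Stated for one direction so that both formulas are instances of it.\<close>

lemma orbit_equivalence_entropy:
  fixes RA :: "'a cstar" and RB :: "'b cstar"
  assumes A: "gauge_kms A RA SA \<gamma>A \<iota>A a \<phi>A" and B: "gauge_kms B RB SB \<gamma>B \<iota>B b \<phi>B"
    and hom: "homeomorphism (markov_space A) (markov_space B) h g"
    and cont: "continuous_on (markov_space A) k" "continuous_on (markov_space A) l"
    and orbit: "\<And>x. x \<in> markov_space A \<Longrightarrow> (shift ^^ k x) (h (shift x)) = (shift ^^ l x) (h x)"
  shows "\<exists>L. (\<lambda>n. 1 / real n * ln (Re (\<phi>A (\<iota>A (cocycle_weight A b (cocycle k l) n))))) \<longlonglongrightarrow> L \<and>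
    topological_entropy (markov_space A) shift = ereal (- L)"
proof -
  interpret GA: gauge_kms A RA SA \<gamma>A \<iota>A a \<phi>A by (rule A)
  interpret GB: gauge_kms B RB SB \<gamma>B \<iota>B b \<phi>B by (rule B)
  interpret orbit_map A GA.meas a B GB.meas b h g k l
    using hom cont orbit by unfold_locales
  define z where "z w = (SOME x. x \<in> cylinder A w)" for w
  have z: "z w \<in> cylinder A w" if "w \<in> words A n" for w n
  proof -
    have "\<exists>x. x \<in> cylinder A w" using that by (auto simp: words_def cylinder_initial_word)
    then show ?thesis unfolding z_def by (rule someI_ex)
  qed
  have "Re (\<phi>A (\<iota>A (cocycle_weight A b (cocycle k l) n))) = (\<Sum>w\<in>words A (n + level).
      b powr (- real_of_int (cocycle_sum (cocycle k l) n (z w))) * GA.meas (cylinder A w))" for n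
    unfolding cocycle_weight_def
  proof (rule GA.\<phi>_\<iota>_determined[OF _ z])
    fix x y assume "x \<in> markov_space A" "y \<in> markov_space A"
      "initial_word (n + level) x = initial_word (n + level) y"
    then have "cocycle_sum (cocycle k l) n x = cocycle_sum (cocycle k l) n y"
      by (rule cocycle_sum_locally_constant)
    then show "b powr (- real_of_int (cocycle_sum (cocycle k l) n x)) =
        b powr (- real_of_int (cocycle_sum (cocycle k l) n y))" by (rule arg_cong)
  qed
  \<comment> \<open>The number \<open>ln a\<close> appears twice: as the decay rate of the weights
    and, by word counting, as the entropy.\<close>
  from weight_growth_rate[where z = "\<lambda>_. z", OF this z]
  show ?thesis using GA.topological_entropy_eq by (intro exI[of _ "- ln a"]) simp
qed

theorem theorem1p1:
  fixes A B :: "nat mat"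
    and OA :: "'a cstar" and OB :: "'b cstar"
    and SA :: "nat \<Rightarrow> 'a" and SB :: "nat \<Rightarrow> 'b"
    and \<gamma>A :: "real \<Rightarrow> 'a \<Rightarrow> 'a" and \<gamma>B :: "real \<Rightarrow> 'b \<Rightarrow> 'b"
    and \<iota>A :: "((nat \<Rightarrow> nat) \<Rightarrow> complex) \<Rightarrow> 'a" and \<iota>B :: "((nat \<Rightarrow> nat) \<Rightarrow> complex) \<Rightarrow> 'b"
    and \<phi>A :: "'a \<Rightarrow> complex" and \<phi>B :: "'b \<Rightarrow> complex"
    and h g :: "(nat \<Rightarrow> nat) \<Rightarrow> nat \<Rightarrow> nat"
    and k\<^sub>1 l\<^sub>1 k\<^sub>2 l\<^sub>2 :: "(nat \<Rightarrow> nat) \<Rightarrow> nat"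
    and c\<^sub>1 c\<^sub>2 :: "(nat \<Rightarrow> nat) \<Rightarrow> int"
    and r\<^sub>A r\<^sub>B :: real
  assumes "zero_one_mat A" and "irreducible_mat A" and "\<not> permutation_mat A"
    and "zero_one_mat B" and "irreducible_mat B" and "\<not> permutation_mat B"
    and "continuous_orbit_equivalence A B h g k\<^sub>1 l\<^sub>1 k\<^sub>2 l\<^sub>2"
    and "c\<^sub>1 = cocycle k\<^sub>1 l\<^sub>1" and "c\<^sub>2 = cocycle k\<^sub>2 l\<^sub>2"
    and "r\<^sub>A = perron_eigenvalue A" and "r\<^sub>B = perron_eigenvalue B"
    and "cuntz_krieger_algebra A OA SA" and "cuntz_krieger_algebra B OB SB"
    and "diagonal_identification A OA SA \<iota>A" and "diagonal_identification B OB SB \<iota>B"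
    and "gauge_action A OA SA \<gamma>A" and "gauge_action B OB SB \<gamma>B"
    and "kms_state OA \<gamma>A r\<^sub>A \<phi>A" and "kms_state OB \<gamma>B r\<^sub>B \<phi>B"
  shows "(\<exists>L. (\<lambda>n. 1 / real n * ln (Re (\<phi>A (\<iota>A (cocycle_weight A r\<^sub>B c\<^sub>1 n))))) \<longlonglongrightarrow> L \<and>
            topological_entropy (markov_space A) shift = ereal (- L)) \<and>
         (\<exists>L. (\<lambda>n. 1 / real n * ln (Re (\<phi>B (\<iota>B (cocycle_weight B r\<^sub>A c\<^sub>2 n))))) \<longlonglongrightarrow> L \<and>
            topological_entropy (markov_space B) shift = ereal (- L))"
proof -
  have A: "gauge_kms A OA SA \<gamma>A \<iota>A r\<^sub>A \<phi>A" and B: "gauge_kms B OB SB \<gamma>B \<iota>B r\<^sub>B \<phi>B"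
    using assms by (auto simp: gauge_kms_def gauge_kms_axioms_def markov_shift_def cuntz_krieger_algebra_def)
  have coe: "homeomorphism (markov_space A) (markov_space B) h g"
    "continuous_on (markov_space A) k\<^sub>1" "continuous_on (markov_space A) l\<^sub>1"
    "continuous_on (markov_space B) k\<^sub>2" "continuous_on (markov_space B) l\<^sub>2"
    "\<And>x. x \<in> markov_space A \<Longrightarrow> (shift ^^ k\<^sub>1 x) (h (shift x)) = (shift ^^ l\<^sub>1 x) (h x)"
    "\<And>y. y \<in> markov_space B \<Longrightarrow> (shift ^^ k\<^sub>2 y) (g (shift y)) = (shift ^^ l\<^sub>2 y) (g y)"
    using assms(7) unfolding continuous_orbit_equivalence_def by blast+
  show ?thesis
    unfolding \<open>c\<^sub>1 = cocycle k\<^sub>1 l\<^sub>1\<close> \<open>c\<^sub>2 = cocycle k\<^sub>2 l\<^sub>2\<close>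
  proof
    show "\<exists>L. (\<lambda>n. 1 / real n * ln (Re (\<phi>A (\<iota>A (cocycle_weight A r\<^sub>B (cocycle k\<^sub>1 l\<^sub>1) n))))) \<longlonglongrightarrow> L \<and>
        topological_entropy (markov_space A) shift = ereal (- L)"
      by (rule orbit_equivalence_entropy[OF A B coe(1-3,6)])
    \<comment> \<open>The second formula is the first one for the inverse homeomorphism
      \<open>g\<close>, with the two shifts exchanged.\<close>
    show "\<exists>L. (\<lambda>n. 1 / real n * ln (Re (\<phi>B (\<iota>B (cocycle_weight B r\<^sub>A (cocycle k\<^sub>2 l\<^sub>2) n))))) \<longlonglongrightarrow> L \<and>
        topological_entropy (markov_space B) shift = ereal (- L)"
      by (rule orbit_equivalence_entropy[OF B A homeomorphism_symD[OF coe(1)] coe(4,5,7)])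
  qed
qed

end
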